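(* Let $(a_n)_{n\ge0}$ be a sequence of positive reals, and consider the weight function $w_0(h,t)=a_{h+t}$, $w_1(h,t)=1$ on $\mathbb Z_+^2$, with $\mathcal P=\mathcal P(w)$. If $$\sum_{n=0}^\infty \frac{a_n}{(1+a_n)^2}<\infty,$$ then $$\mathrm{ext}\,\mathcal P=\{P_z^*: z\in R\}\cup\{Q_{0,\infty},Q_{\infty,0}\}.$$
   Context: Consider the lattice $\mathbb Z_+^2$ with directed edges $(h,t)\to(h+1,t)$ and $(h,t)\to(h,t+1)$, carrying strictly positive weights $w_1(h,t)$ and $w_0(h,t)$ respectively. A standard path starts at $(0,0)$ and moves along directed edges. The weight of a finite path is the product of the weights of its edges; $d(h,t)$ is the sum of the weights of all standard paths with endpoint $(h,t)$. $\mathcal P=\mathcal P(w)$ is the set of probability laws $P$ of random infinite standard paths $S=(S_n)_{n\ge 0}$, $S_n=(H_n,T_n)$, $H_n+T_n=n$, with the conditioning property: whenever $P(S_{h+t}=(h,t))>0$, given $S_{h+t}=(h,t)$ the conditional probability of each standard path with endpoint $(h,t)$ is the weight of that path divided by $d(h,t)$. $\mathcal P$ is convex; $\mathrm{ext}\,\mathcal P$ denotes its set of extreme points. $Q_{0,\infty}$ and $Q_{\infty,0}$ are the laws supported by the single path with $H_n=0$ for all $n$, respectively $T_n=0$ for all $n$. Let $p(n)=1/(1+a_n)$ and $q(n)=a_n/(1+a_n)$. $P^*\in\mathcal P$ is the law under which the increments $S_{n+1}-S_n$, $n\ge0$, are independent, equal to $(1,0)$ with probability $p(n)$ and to $(0,1)$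 with probability $q(n)$. Let $L_n=\{0\le m<n: p(m)\le q(m)\}$ and $M_n=\{0\le m<n: p(m)>q(m)\}$. When $\sum_n a_n/(1+a_n)^2=\sum_n p(n)q(n)<\infty$, one has $P^*$-almost surely $(H_n,T_n)-(\#M_n,\#L_n)\to(Z,-Z)$ for some integer-valued random variable $Z$. $R=\{z\in\mathbb Z: P^*(Z=z)>0\}$ is the range of $Z$, and for $z\in R$, $P_z^*$ is the law $P^*$ conditioned on the event $Z=z$. *)

theory Defs
  imports "HOL-Probability.Probability"
begin

section \<open>Paths and their weights\<close>

definition lattice_edge :: "nat \<times> nat \<Rightarrow> nat \<times> nat \<Rightarrow> bool" where
  "lattice_edge u v \<longleftrightarrow> v = (Suc (fst u), snd u) \<or> v = (fst u, Suc (snd u))"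

definition standard_path :: "(nat \<Rightarrow> nat \<times> nat) \<Rightarrow> bool" where
  "standard_path S \<longleftrightarrow> S 0 = (0, 0) \<and> (\<forall>n. lattice_edge (S n) (S (Suc n)))"

text \<open>A finite standard path is the list of the vertices it visits.\<close>

definition finite_standard_path :: "(nat \<times> nat) list \<Rightarrow> bool" where
  "finite_standard_path xs \<longleftrightarrow>
     xs \<noteq> [] \<and> hd xs = (0, 0) \<and> (\<forall>i. Suc i < length xs \<longrightarrow> lattice_edge (xs ! i) (xs ! Suc i))"

definition paths_to :: "nat \<Rightarrow> nat \<Rightarrow> (nat \<times> nat) list set" where
  "paths_to h t = {xs. finite_standard_path xs \<and> last xs = (h, t)}"

text \<open>The weights are \<open>w0 h t\<close> for the edge from \<open>(h, t)\<close> to \<open>(h, t + 1)\<close> and \<open>w1 h t\<close> for the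
  edge from \<open>(h, t)\<close> to \<open>(h + 1, t)\<close>; \<open>edge_weight w0 w1 u v\<close> is meaningful only when
  \<open>lattice_edge u v\<close>.\<close>

definition edge_weight ::
  "(nat \<Rightarrow> nat \<Rightarrow> real) \<Rightarrow> (nat \<Rightarrow> nat \<Rightarrow> real) \<Rightarrow> nat \<times> nat \<Rightarrow> nat \<times> nat \<Rightarrow> real" where
  "edge_weight w0 w1 u v =
     (if v = (Suc (fst u), snd u) then w1 (fst u) (snd u) else w0 (fst u) (snd u))"

definition path_weight ::
  "(nat \<Rightarrow> nat \<Rightarrow> real) \<Rightarrow> (nat \<Rightarrow> nat \<Rightarrow> real) \<Rightarrow> (nat \<times> nat) list \<Rightarrow> real" where
  "path_weight w0 w1 xs = (\<Prod>i<length xs - 1. edge_weight w0 w1 (xs ! i) (xs ! Suc i))"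

definition path_dim ::
  "(nat \<Rightarrow> nat \<Rightarrow> real) \<Rightarrow> (nat \<Rightarrow> nat \<Rightarrow> real) \<Rightarrow> nat \<Rightarrow> nat \<Rightarrow> real" where
  "path_dim w0 w1 h t = (\<Sum>xs\<in>paths_to h t. path_weight w0 w1 xs)"

lemma finite_standard_path_nth:
  assumes "finite_standard_path xs" "i < length xs"
  shows "fst (xs ! i) + snd (xs ! i) = i"
  using assms(2)
proof (induction i)
  case 0
  then show ?case using assms(1) by (simp add: finite_standard_path_def hd_conv_nth)
next
  case (Suc i)
  then have "lattice_edge (xs ! i) (xs ! Suc i)"
    using assms(1) by (simp add: finite_standard_path_def)
  with Suc show ?case by (auto simp: lattice_edge_def)
qed

lemma length_paths_to:
  assumes "xs \<in> paths_to h t"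
  shows "length xs = Suc (h + t)"
proof -
  have ne: "xs \<noteq> []" and "last xs = (h, t)"
    using assms by (auto simp: paths_to_def finite_standard_path_def)
  then have "xs ! (length xs - 1) = (h, t)" by (simp add: last_conv_nth)
  moreover have "fst (xs ! (length xs - 1)) + snd (xs ! (length xs - 1)) = length xs - 1"
    using assms ne by (intro finite_standard_path_nth) (auto simp: paths_to_def)
  moreover have "0 < length xs" using ne by simp
  ultimately show ?thesis by simp
qed

lemma finite_paths_to: "finite (paths_to h t)"
proof (rule finite_subset)
  show "paths_to h t \<subseteq> {xs. set xs \<subseteq> {..h + t} \<times> {..h + t} \<and> length xs = Suc (h + t)}"
  proof (intro subsetI CollectI conjI)
    fix xs v assume xs: "xs \<in> paths_to h t" and "v \<in> set xs"
    then obtain i where i: "i < length xs" "v = xs ! i" by (auto simp: in_set_conv_nth)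
    then have "fst v + snd v = i"
      using xs finite_standard_path_nth by (auto simp: paths_to_def)
    then show "v \<in> {..h + t} \<times> {..h + t}"
      using i length_paths_to[OF xs] by (auto simp: mem_Times_iff)
  qed (rule length_paths_to)
qed (intro finite_lists_length_eq finite_cartesian_product; simp)


section \<open>Laws of random infinite standard paths\<close>

definition path_space :: "(nat \<Rightarrow> nat \<times> nat) measure" where
  "path_space = restrict_space (\<Pi>\<^sub>M n\<in>UNIV. count_space UNIV) {S. standard_path S}"

text \<open>For \<open>\<gamma> \<in> paths_to h t\<close>, the predicate \<open>map S [0..<Suc (h + t)] = \<gamma>\<close> says that the first
  \<open>h + t\<close> steps of \<open>S\<close> follow \<open>\<gamma>\<close>.\<close>

definition path_laws ::
  "(nat \<Rightarrow> nat \<Rightarrow> real) \<Rightarrow> (nat \<Rightarrow> nat \<Rightarrow> real) \<Rightarrow> (nat \<Rightarrow> nat \<times> nat) measure set" where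
  "path_laws w0 w1 =
     {P. prob_space P \<and> sets P = sets path_space \<and>
        (\<forall>h t. \<P>(S in P. S (h + t) = (h, t)) > 0 \<longrightarrow>
           (\<forall>\<gamma>\<in>paths_to h t.
              \<P>(S in P. map S [0..<Suc (h + t)] = \<gamma> \<bar> S (h + t) = (h, t))
                = path_weight w0 w1 \<gamma> / path_dim w0 w1 h t))}"

text \<open>Measures do not form a real vector space, so \<open>extreme_point_of\<close> does not apply. Here the
  convex combination of two laws is taken setwise.\<close>

definition extreme_laws :: "'a measure set \<Rightarrow> 'a measure set" where
  "extreme_laws C =
     {P\<in>C. \<forall>P1\<in>C. \<forall>P2\<in>C. \<forall>u::real.
        0 < u \<and> u < 1 \<and> (\<forall>A\<in>sets P. measure P A = u * measure P1 A + (1 - u) * measure P2 A)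
        \<longrightarrow> P1 = P \<and> P2 = P}"

definition Q_0_inf :: "(nat \<Rightarrow> nat \<times> nat) measure" where
  "Q_0_inf = return path_space (\<lambda>n. (0, n))"

definition Q_inf_0 :: "(nat \<Rightarrow> nat \<times> nat) measure" where
  "Q_inf_0 = return path_space (\<lambda>n. (n, 0))"


section \<open>The law with independent increments\<close>

definition prob_h :: "(nat \<Rightarrow> real) \<Rightarrow> nat \<Rightarrow> real" where
  "prob_h a n = 1 / (1 + a n)"

definition prob_t :: "(nat \<Rightarrow> real) \<Rightarrow> nat \<Rightarrow> real" where
  "prob_t a n = a n / (1 + a n)"

text \<open>\<open>\<omega> n\<close> tells whether the step from time \<open>n\<close> to time \<open>n + 1\<close> is \<open>(1, 0)\<close>.\<close>

definition path_of_steps :: "(nat \<Rightarrow> bool) \<Rightarrow> nat \<Rightarrow> nat \<times> nat" where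
  "path_of_steps \<omega> n = (card {m. m < n \<and> \<omega> m}, card {m. m < n \<and> \<not> \<omega> m})"

definition P_star :: "(nat \<Rightarrow> real) \<Rightarrow> (nat \<Rightarrow> nat \<times> nat) measure" where
  "P_star a =
     distr (\<Pi>\<^sub>M n\<in>UNIV. measure_pmf (bernoulli_pmf (prob_h a n))) path_space path_of_steps"

definition L_set :: "(nat \<Rightarrow> real) \<Rightarrow> nat \<Rightarrow> nat set" where
  "L_set a n = {m. m < n \<and> prob_h a m \<le> prob_t a m}"

definition M_set :: "(nat \<Rightarrow> real) \<Rightarrow> nat \<Rightarrow> nat set" where
  "M_set a n = {m. m < n \<and> prob_h a m > prob_t a m}"

text \<open>\<open>Z_lim a S\<close> is unspecified on paths for which the limit does not exist.\<close>

definition Z_lim :: "(nat \<Rightarrow> real) \<Rightarrow> (nat \<Rightarrow> nat \<times> nat) \<Rightarrow> int" where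
  "Z_lim a S =
     (THE z. (\<lambda>n. (int (fst (S n)) - int (card (M_set a n)),
                   int (snd (S n)) - int (card (L_set a n)))) \<longlonglongrightarrow> (z, - z))"

definition Z_range :: "(nat \<Rightarrow> real) \<Rightarrow> int set" where
  "Z_range a = {z. \<P>(S in P_star a. Z_lim a S = z) > 0}"

definition P_star_cond :: "(nat \<Rightarrow> real) \<Rightarrow> int \<Rightarrow> (nat \<Rightarrow> nat \<times> nat) measure" where
  "P_star_cond a z = uniform_measure (P_star a) {S\<in>space (P_star a). Z_lim a S = z}"


subsection \<open>Increments under \<open>P_star\<close>\<close>

definition increment :: "nat \<Rightarrow> (nat \<Rightarrow> nat \<times> nat) \<Rightarrow> nat \<times> nat" where
  "increment n S = (fst (S (Suc n)) - fst (S n), snd (S (Suc n)) - snd (S n))"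

lemma path_of_steps_Suc:
  "path_of_steps \<omega> (Suc n) =
     (if \<omega> n then (Suc (fst (path_of_steps \<omega> n)), snd (path_of_steps \<omega> n))
      else (fst (path_of_steps \<omega> n), Suc (snd (path_of_steps \<omega> n))))"
proof -
  have "{m. m < Suc n \<and> P m} = (if P n then insert n {m. m < n \<and> P m} else {m. m < n \<and> P m})"
    for P :: "nat \<Rightarrow> bool"
    by (auto simp: less_Suc_eq)
  from this[of \<omega>] this[of "\<lambda>m. \<not> \<omega> m"] show ?thesis
    by (simp add: path_of_steps_def)
qed

lemma standard_path_of_steps: "standard_path (path_of_steps \<omega>)"
  by (simp add: standard_path_def lattice_edge_def path_of_steps_Suc)
     (simp add: path_of_steps_def)

lemma increment_path_of_steps:
  "increment n (path_of_steps \<omega>) = (if \<omega> n then (1, 0) else (0, 1))"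
  by (simp add: increment_def path_of_steps_Suc)

lemma measurable_path_of_steps:
  "path_of_steps \<in> measurable (\<Pi>\<^sub>M n\<in>UNIV. measure_pmf (bernoulli_pmf (p n))) path_space"
proof -
  let ?M = "\<Pi>\<^sub>M n\<in>UNIV. measure_pmf (bernoulli_pmf (p n))"
  have "(\<lambda>\<omega>. path_of_steps \<omega> n) \<in> measurable ?M (count_space UNIV)" for n
  proof (induction n)
    case 0
    then show ?case by (simp add: path_of_steps_def)
  next
    case (Suc n)
    have [measurable]: "(\<lambda>\<omega>. \<omega> n) \<in> measurable ?M (count_space UNIV)"
      using measurable_component_singleton[of n UNIV "\<lambda>n. measure_pmf (bernoulli_pmf (p n))"]
      by simp
    note Suc [measurable]
    show ?case unfolding path_of_steps_Suc by measurable
  qed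
  then have "path_of_steps \<in> measurable ?M (\<Pi>\<^sub>M n\<in>UNIV. count_space UNIV)"
    by (intro measurable_PiM_single') auto
  then show ?thesis
    unfolding path_space_def
    by (intro measurable_restrict_space2) (auto simp: standard_path_of_steps)
qed

lemma prob_space_P_star: "prob_space (P_star a)"
proof -
  interpret product_prob_space "\<lambda>n. measure_pmf (bernoulli_pmf (prob_h a n))" UNIV
    by standard
  show ?thesis
    unfolding P_star_def by (intro prob_space_distr measurable_path_of_steps)
qed

lemma measurable_increment: "increment n \<in> measurable path_space (count_space UNIV)"
proof -
  let ?N = "count_space (UNIV :: (nat \<times> nat) set)"
  have "(\<lambda>S. S m) \<in> measurable path_space ?N" for m
    unfolding path_space_def
    by (intro measurable_restrict_space1 measurable_component_singleton UNIV_I)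
  then have "(\<lambda>S. (S n, S (Suc n))) \<in> measurable path_space (?N \<Otimes>\<^sub>M ?N)"
    by (intro measurable_Pair)
  also have "?N \<Otimes>\<^sub>M ?N = count_space UNIV"
    by (subst pair_measure_countable) auto
  finally have "(\<lambda>S. (S n, S (Suc n))) \<in> measurable path_space (count_space UNIV)" .
  moreover have "(\<lambda>(u, v). (fst v - fst u, snd v - snd u)) \<in> measurable (count_space UNIV) (count_space UNIV)"
    by (rule measurable_count_space)
  ultimately have "(\<lambda>S. (\<lambda>(u, v). (fst v - fst u, snd v - snd u)) (S n, S (Suc n)))
                     \<in> measurable path_space (count_space UNIV)"
    by (rule measurable_compose)
  then show ?thesis unfolding increment_def[abs_def] split .
qed

lemma P_star_increment_h:
  assumes "a n > 0"
  shows "\<P>(S in P_star a. increment n S = (1, 0)) = prob_h a n"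
proof -
  let ?p = "\<lambda>n. measure_pmf (bernoulli_pmf (prob_h a n))"
  interpret product_prob_space ?p UNIV by standard
  have "\<P>(S in P_star a. increment n S = (1, 0)) = measure (PiM UNIV ?p) {\<omega>. \<omega> n}"
    unfolding P_star_def using measurable_increment[of n]
    by (subst measure_distr[OF measurable_path_of_steps])
       (auto simp: increment_path_of_steps space_PiM intro!: arg_cong2[where f = measure]
         measurable_space[OF measurable_path_of_steps])
  also have "{\<omega>. \<omega> n} = {\<omega>\<in>space (PiM UNIV ?p). \<omega> n \<in> {True}}"
    by (simp add: space_PiM)
  also have "measure (PiM UNIV ?p) \<dots> = measure (?p n) {True}"
    using emeasure_PiM_Collect_single[of n "{True}"] by (simp add: measure_def)
  also have "\<dots> = prob_h a n"
    using assms by (simp add: measure_pmf_single prob_h_def)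
  finally show ?thesis .
qed

lemma P_star_increment_t:
  assumes "a n > 0"
  shows "\<P>(S in P_star a. increment n S = (0, 1)) = prob_t a n"
proof -
  interpret prob_space "P_star a" by (rule prob_space_P_star)
  have space: "space (P_star a) = Collect standard_path"
    by (simp add: P_star_def path_space_def space_restrict_space space_PiM)
  have "\<P>(S in P_star a. increment n S = (0, 1)) = \<P>(S in P_star a. increment n S \<noteq> (1, 0))"
  proof (rule arg_cong[where f = prob], intro Collect_cong conj_cong refl)
    fix S assume "S \<in> space (P_star a)"
    then have "lattice_edge (S n) (S (Suc n))" by (simp add: space standard_path_def)
    then show "increment n S = (0, 1) \<longleftrightarrow> increment n S \<noteq> (1, 0)"
      by (auto simp: lattice_edge_def increment_def)
  qed
  also have "\<dots> = 1 - \<P>(S in P_star a. increment n S = (1, 0))"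
  proof (rule prob_neg)
    have "increment n \<in> measurable (P_star a) (count_space UNIV)"
      using measurable_increment[of n] by (simp add: P_star_def)
    from measurable_sets[OF this, of "{(1, 0)}"]
    show "{S \<in> space (P_star a). increment n S = (1, 0)} \<in> events"
      by (simp add: vimage_def Int_def conj_commute)
  qed
  also have "\<dots> = prob_t a n"
    using assms P_star_increment_h[of a n] by (simp add: prob_h_def prob_t_def field_simps)
  finally show ?thesis .
qed

lemma indep_increments_P_star:
  "prob_space.indep_vars (P_star a) (\<lambda>_. count_space UNIV) increment UNIV"
proof -
  let ?p = "\<lambda>n. measure_pmf (bernoulli_pmf (prob_h a n))"
  let ?C = "\<lambda>_::nat. count_space (UNIV :: (nat \<times> nat) set)"
  let ?g = "\<lambda>n \<omega>. if \<omega> n then (1::nat, 0::nat) else (0, 1)"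
  interpret P: product_prob_space ?p UNIV by standard
  interpret prob_space "P_star a" by (rule prob_space_P_star)
  have comp: "(\<lambda>\<omega>. \<omega> n) \<in> measurable (PiM UNIV ?p) (?p n)" for n
    by (rule measurable_component_singleton) simp
  have "P.indep_vars ?p (\<lambda>n \<omega>. \<omega> n) UNIV"
  proof (subst P.indep_vars_iff_distr_eq_PiM)
    have "distr (PiM UNIV ?p) (?p n) (\<lambda>\<omega>. \<omega> n) = ?p n" for n
      by (rule distr_PiM_component) (auto simp: prob_space_measure_pmf)
    moreover have "distr (PiM UNIV ?p) (PiM UNIV ?p) (\<lambda>\<omega>. restrict \<omega> UNIV) = PiM UNIV ?p"
      unfolding restrict_UNIV by (rule distr_id2) simp
    ultimately show "distr (PiM UNIV ?p) (PiM UNIV ?p) (\<lambda>\<omega>. \<lambda>n\<in>UNIV. \<omega> n)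
                       = PiM UNIV (\<lambda>n. distr (PiM UNIV ?p) (?p n) (\<lambda>\<omega>. \<omega> n))"
      by simp
  qed (use comp in auto)
  then have "P.indep_vars ?C ?g UNIV"
    by (rule P.indep_vars_compose2[where Y = "\<lambda>_ b. if b then (1, 0) else (0, 1)"]) simp
  moreover have "?g n \<in> measurable (PiM UNIV ?p) (count_space UNIV)" for n
    by (rule measurable_compose[OF comp]) simp
  ultimately have g: "distr (PiM UNIV ?p) (PiM UNIV ?C) (\<lambda>\<omega>. \<lambda>n\<in>UNIV. ?g n \<omega>)
                        = PiM UNIV (\<lambda>n. distr (PiM UNIV ?p) (count_space UNIV) (?g n))"
    using P.indep_vars_iff_distr_eq_PiM[of UNIV ?g ?C] by simp
  have rv: "increment n \<in> measurable (P_star a) (count_space UNIV)" for n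
    using measurable_increment[of n] by (simp add: P_star_def)
  have joint: "(\<lambda>S. \<lambda>n\<in>UNIV. increment n S) \<in> measurable path_space (PiM UNIV ?C)"
    by (rule measurable_restrict) (rule measurable_increment)
  have "distr (P_star a) (PiM UNIV ?C) (\<lambda>S. \<lambda>n\<in>UNIV. increment n S)
          = PiM UNIV (\<lambda>n. distr (P_star a) (count_space UNIV) (increment n))"
    using g unfolding P_star_def
    by (simp add: distr_distr[OF joint measurable_path_of_steps]
        distr_distr[OF measurable_increment measurable_path_of_steps]
        comp_def increment_path_of_steps)
  then show ?thesis
    using rv by (subst indep_vars_iff_distr_eq_PiM) auto
qed

end

theory Submission
  imports Defs
begin

text \<open>Let \<open>D n\<close> be \<open>H n\<close> minus the number of \<open>m < n\<close> with \<open>p m > q m\<close>. If \<open>P\<close> is extreme, then each event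
  of the form \<open>S n \<in> G n\<close> eventually, being independent of the past given the present, has probability
  0 or 1, because conditioning on it stays inside the set of laws. Hence either \<open>D n = z\<close> infinitely
  often almost surely, for some \<open>z\<close>, or \<open>D\<close> tends to plus or minus infinity almost surely.

  In the first case, decompose according to the last visit of \<open>z\<close> before a large time \<open>N\<close>: given
  \<open>D n = z\<close>, the past of \<open>P\<close> is the past of \<open>P_star\<close> given \<open>D n = z\<close>, which converges to \<open>P_star\<close>
  given \<open>Z = z\<close>, since \<open>D\<close> is eventually constant under \<open>P_star\<close>. So \<open>P\<close> is determined by recurrence
  at \<open>z\<close>, which also shows that each \<open>P_star_cond a z\<close> is extreme.

  In the second case, removing a horizontal step at a time with \<open>p \<le> q\<close> shows that
  \<open>P_star (D n = z + 1) / P_star (D n = z)\<close> is at most \<open>C / (z + 1)\<close> for \<open>z \<ge> 0\<close>, uniformly in \<open>n\<close>. Adding a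
  horizontal step at a fixed time \<open>j\<close> then bounds the conditional probability of a vertical step at
  \<open>j\<close> given \<open>D n = z\<close> by a multiple of \<open>1 / (z + 1)\<close>, so almost surely no step is vertical; the other
  direction is symmetric.\<close>


section \<open>Finite paths\<close>

text \<open>The list has \<open>n + 1\<close> entries, the starting point included, and at
  \<open>n = h + t\<close> it is the list that occurs in \<open>path_laws\<close>.\<close>

definition history :: "nat \<Rightarrow> (nat \<Rightarrow> 'a) \<Rightarrow> 'a list" where
  "history n S = map S [0..<Suc n]"

lemma length_history [simp]: "length (history n S) = Suc n"
  by (simp add: history_def)

lemma history_nth [simp]: "i \<le> n \<Longrightarrow> history n S ! i = S i"
  by (simp add: history_def del: upt_Suc)

lemma history_eq_iff: "history n S = \<gamma> \<longleftrightarrow> length \<gamma> = Suc n \<and> (\<forall>i\<le>n. S i = \<gamma> ! i)"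
  by (auto simp: list_eq_iff_nth_eq less_Suc_eq_le)

lemma history_cong_iff: "history n S = history n S' \<longleftrightarrow> (\<forall>i\<le>n. S i = S' i)"
  by (auto simp: history_eq_iff)

lemma history_Suc: "history (Suc n) S = history n S @ [S (Suc n)]"
  by (simp add: history_def)

lemma last_history [simp]: "last (history n S) = S n"
  by (simp add: history_def)

text \<open>Inverse of \<open>path_of_steps\<close> on standard paths; \<open>True\<close> stands
  for a horizontal step.\<close>

definition steps_of :: "(nat \<Rightarrow> nat \<times> nat) \<Rightarrow> nat \<Rightarrow> bool" where
  "steps_of S n \<longleftrightarrow> fst (S (Suc n)) = Suc (fst (S n))"

lemma standard_path_Suc:
  assumes "standard_path S"
  shows "S (Suc n) = (if steps_of S n then (Suc (fst (S n)), snd (S n)) else (fst (S n), Suc (snd (S n))))"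
  using assms by (auto simp: standard_path_def lattice_edge_def steps_of_def dest: spec[of _ n])

lemma standard_path_sum: "standard_path S \<Longrightarrow> fst (S n) + snd (S n) = n"
  by (induction n) (simp add: standard_path_def, simp add: standard_path_Suc)

lemma standard_path_eq_iff: "standard_path S \<Longrightarrow> h + t = n \<Longrightarrow> S n = (h, t) \<longleftrightarrow> fst (S n) = h"
  using standard_path_sum[of S n] by (auto simp: prod_eq_iff)

lemma steps_of_path_of_steps [simp]: "steps_of (path_of_steps \<omega>) = \<omega>"
  by (rule ext) (simp add: steps_of_def path_of_steps_Suc)

lemma path_of_steps_steps_of:
  assumes "standard_path S"
  shows "path_of_steps (steps_of S) = S"
proof
  fix n show "path_of_steps (steps_of S) n = S n"
  proof (induction n)
    case 0
    then show ?case using assms by (simp add: standard_path_def path_of_steps_def)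
  next
    case (Suc n)
    then show ?case using assms by (simp add: standard_path_Suc path_of_steps_Suc)
  qed
qed

lemma path_of_steps_cong:
  assumes "\<And>m. m < n \<Longrightarrow> \<omega> m = \<omega>' m"
  shows "path_of_steps \<omega> n = path_of_steps \<omega>' n"
  unfolding path_of_steps_def using assms by (auto intro!: arg_cong[where f = card])

text \<open>Step \<open>m\<close> is visible in the vertices at times \<open>m\<close> and
  \<open>m + 1\<close>, so the \<open>n + 1\<close> vertices up to time \<open>n\<close> reveal
  exactly the steps below \<open>n\<close>.\<close>

lemma history_path_of_steps_eq_iff:
  "history n (path_of_steps \<omega>) = history n (path_of_steps \<omega>') \<longleftrightarrow> (\<forall>m<n. \<omega> m = \<omega>' m)"
proof
  assume eq: "history n (path_of_steps \<omega>) = history n (path_of_steps \<omega>')"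
  show "\<forall>m<n. \<omega> m = \<omega>' m"
  proof (intro allI impI)
    fix m assume "m < n"
    then have "steps_of (path_of_steps \<omega>) m = steps_of (path_of_steps \<omega>') m"
      using eq unfolding history_cong_iff steps_of_def by simp
    then show "\<omega> m = \<omega>' m" by simp
  qed
next
  assume "\<forall>m<n. \<omega> m = \<omega>' m"
  then show "history n (path_of_steps \<omega>) = history n (path_of_steps \<omega>')"
    unfolding history_cong_iff by (auto intro!: path_of_steps_cong)
qed

lemma history_in_paths_to:
  assumes "standard_path S" "S (h + t) = (h, t)"
  shows "history (h + t) S \<in> paths_to h t"
proof -
  have "history (h + t) S \<noteq> []" by (simp add: history_def)
  then show ?thesis
    using assms by (simp add: paths_to_def finite_standard_path_def hd_conv_nth standard_path_def)
qed

text \<open>Continuing a finite path by horizontal steps forever gives an infinite one, so facts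
  about infinite standard paths become available for lists.\<close>

lemma paths_to_history:
  assumes "\<gamma> \<in> paths_to h t"
  obtains S where "standard_path S" "\<gamma> = history (h + t) S" "S (h + t) = (h, t)"
proof -
  define S where "S i = (if i \<le> h + t then \<gamma> ! i else (h + (i - (h + t)), t))" for i
  have len: "length \<gamma> = Suc (h + t)" using assms by (rule length_paths_to)
  have \<gamma>: "finite_standard_path \<gamma>" "last \<gamma> = (h, t)" using assms by (auto simp: paths_to_def)
  have last_\<gamma>: "\<gamma> ! (h + t) = (h, t)" using \<gamma> len by (auto simp: last_conv_nth finite_standard_path_def)
  show thesis
  proof
    show "\<gamma> = history (h + t) S" using len by (simp add: list_eq_iff_nth_eq S_def)
    show "S (h + t) = (h, t)" using last_\<gamma> by (simp add: S_def)
    have "lattice_edge (S n) (S (Suc n))" for n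
    proof (cases "n < h + t")
      case True
      then show ?thesis using \<gamma> len by (simp add: S_def finite_standard_path_def)
    next
      case False
      then show ?thesis using last_\<gamma> by (cases "n = h + t") (auto simp: S_def lattice_edge_def)
    qed
    moreover have "S 0 = (0, 0)"
      using \<gamma> by (auto simp: S_def finite_standard_path_def hd_conv_nth)
    ultimately show "standard_path S" by (simp add: standard_path_def)
  qed
qed

lemma paths_to_steps:
  assumes "\<gamma> \<in> paths_to h t"
  obtains \<omega> where "\<gamma> = history (h + t) (path_of_steps \<omega>)" "path_of_steps \<omega> (h + t) = (h, t)"
  using paths_to_history[OF assms] path_of_steps_steps_of by metis

lemma path_weight_history:
  "path_weight w0 w1 (history n S) = (\<Prod>i<n. edge_weight w0 w1 (S i) (S (Suc i)))"
  by (simp add: path_weight_def)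

lemma path_weight_snoc:
  assumes "\<gamma> \<noteq> []"
  shows "path_weight w0 w1 (\<gamma> @ [v]) = path_weight w0 w1 \<gamma> * edge_weight w0 w1 (last \<gamma>) v"
proof -
  obtain n where n: "length \<gamma> = Suc n" using assms by (cases \<gamma>) auto
  then show ?thesis by (simp add: path_weight_def nth_append last_conv_nth assms)
qed

lemma edge_weight_pos:
  assumes "\<And>h t. w0 h t > 0" "\<And>h t. w1 h t > 0"
  shows "edge_weight w0 w1 u v > 0"
  using assms by (simp add: edge_weight_def)

lemma path_weight_pos:
  assumes "\<And>h t. w0 h t > 0" "\<And>h t. w1 h t > 0"
  shows "path_weight w0 w1 \<gamma> > 0"
  unfolding path_weight_def by (intro prod_pos ballI edge_weight_pos assms)

lemma card_less_add_card_less_not: "card {m. m < n \<and> P m} + card {m. m < n \<and> \<not> P m} = (n::nat)"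
proof -
  have "card ({m. m < n \<and> P m} \<union> {m. m < n \<and> \<not> P m}) = card {m. m < n \<and> P m} + card {m. m < n \<and> \<not> P m}"
    by (intro card_Un_disjoint) auto
  moreover have "{m. m < n \<and> P m} \<union> {m. m < n \<and> \<not> P m} = {..<n}" by auto
  ultimately show ?thesis by simp
qed

text \<open>Taking all \<open>h\<close> horizontal steps first gives a path.\<close>

lemma paths_to_nonempty: "paths_to h t \<noteq> {}"
proof -
  have "card {m. m < h + t \<and> m < h} = h"
    using card_Collect_less_nat[of h] by (metis (no_types, lifting) Collect_cong trans_less_add1)
  then have "path_of_steps (\<lambda>m. m < h) (h + t) = (h, t)"
    using card_less_add_card_less_not[of "h + t" "\<lambda>m. m < h"] by (simp add: path_of_steps_def)
  then show ?thesis using history_in_paths_to standard_path_of_steps by blast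
qed

lemma path_dim_pos:
  assumes "\<And>h t. w0 h t > 0" "\<And>h t. w1 h t > 0"
  shows "path_dim w0 w1 h t > 0"
  unfolding path_dim_def
  by (intro sum_pos finite_paths_to paths_to_nonempty path_weight_pos assms)


section \<open>Paths as sets of horizontal steps\<close>

text \<open>A path of \<open>n\<close> steps is encoded by the set of times of its horizontal steps;
  a layer then corresponds to the paths with a given endpoint.\<close>

definition layer :: "nat \<Rightarrow> nat \<Rightarrow> nat set set" where
  "layer n h = {A. A \<subseteq> {..<n} \<and> card A = h}"

text \<open>Horizontal edges have weight 1 and a vertical edge used at time \<open>j\<close> has
  weight \<open>a j\<close>, so only the times outside \<open>A\<close> contribute.\<close>

definition layer_weight :: "(nat \<Rightarrow> real) \<Rightarrow> nat \<Rightarrow> nat set \<Rightarrow> real" where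
  "layer_weight a n A = (\<Prod>j\<in>{..<n} - A. a j)"

lemma finite_layer [simp]: "finite (layer n h)"
  by (rule finite_subset[of _ "Pow {..<n}"]) (auto simp: layer_def)

lemma bij_betw_layer_paths_to:
  assumes "h + t = n"
  shows "bij_betw (\<lambda>A. history n (path_of_steps (\<lambda>m. m \<in> A))) (layer n h) (paths_to h t)"
proof (rule bij_betw_imageI)
  show "inj_on (\<lambda>A. history n (path_of_steps (\<lambda>m. m \<in> A))) (layer n h)"
    by (rule inj_onI) (auto simp: history_path_of_steps_eq_iff layer_def)
  show "(\<lambda>A. history n (path_of_steps (\<lambda>m. m \<in> A))) ` layer n h = paths_to h t"
  proof (intro equalityI subsetI)
    fix \<gamma> assume "\<gamma> \<in> (\<lambda>A. history n (path_of_steps (\<lambda>m. m \<in> A))) ` layer n h"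
    then obtain A where A: "A \<in> layer n h" "\<gamma> = history n (path_of_steps (\<lambda>m. m \<in> A))" by auto
    then have "{m. m < n \<and> m \<in> A} = A" by (auto simp: layer_def)
    then have "path_of_steps (\<lambda>m. m \<in> A) n = (h, t)"
      using A card_less_add_card_less_not[of n "\<lambda>m. m \<in> A"] assms
      by (simp add: path_of_steps_def layer_def)
    with A show "\<gamma> \<in> paths_to h t"
      using history_in_paths_to[OF standard_path_of_steps] assms by auto
  next
    fix \<gamma> assume "\<gamma> \<in> paths_to h t"
    then obtain \<omega> where \<omega>: "\<gamma> = history n (path_of_steps \<omega>)" "path_of_steps \<omega> n = (h, t)"
      using paths_to_steps assms by metis
    let ?A = "{m. m < n \<and> \<omega> m}"
    have "?A \<in> layer n h" using \<omega> by (auto simp: layer_def path_of_steps_def)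
    moreover have "\<gamma> = history n (path_of_steps (\<lambda>m. m \<in> ?A))"
      unfolding \<omega> history_path_of_steps_eq_iff by simp
    ultimately show "\<gamma> \<in> (\<lambda>A. history n (path_of_steps (\<lambda>m. m \<in> A))) ` layer n h" by blast
  qed
qed

lemma path_weight_path_of_steps:
  "path_weight (\<lambda>h t. a (h + t)) (\<lambda>h t. 1) (history n (path_of_steps \<omega>)) = (\<Prod>j<n. if \<omega> j then 1 else a j)"
  unfolding path_weight_history
proof (intro prod.cong refl)
  fix i
  have "fst (path_of_steps \<omega> i) + snd (path_of_steps \<omega> i) = i"
    using standard_path_sum[OF standard_path_of_steps] .
  then show "edge_weight (\<lambda>h t. a (h + t)) (\<lambda>h t. 1) (path_of_steps \<omega> i) (path_of_steps \<omega> (Suc i)) =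
    (if \<omega> i then 1 else a i)"
    by (simp add: edge_weight_def path_of_steps_Suc)
qed

lemma path_weight_layer:
  "path_weight (\<lambda>h t. a (h + t)) (\<lambda>h t. 1) (history n (path_of_steps (\<lambda>m. m \<in> A))) = layer_weight a n A"
proof -
  have "(\<Prod>j<n. if j \<in> A then 1 else a j) = (\<Prod>j\<in>{..<n} - A. if j \<in> A then 1 else a j)"
    by (rule prod.mono_neutral_right) auto
  then show ?thesis by (simp add: path_weight_path_of_steps layer_weight_def)
qed

text \<open>The predicate \<open>Q\<close> makes the transfer to sets available for part of a layer
  too, such as the paths with a prescribed step.\<close>

lemma sum_paths_to:
  assumes "h + t = n"
  shows "(\<Sum>\<gamma> | \<gamma> \<in> paths_to h t \<and> Q \<gamma>. path_weight (\<lambda>h t. a (h + t)) (\<lambda>h t. 1) \<gamma>) =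
    (\<Sum>A | A \<in> layer n h \<and> Q (history n (path_of_steps (\<lambda>m. m \<in> A))). layer_weight a n A)"
proof -
  let ?f = "\<lambda>A. history n (path_of_steps (\<lambda>m. m \<in> A))"
  have "bij_betw ?f {A. A \<in> layer n h \<and> Q (?f A)} {\<gamma>. \<gamma> \<in> paths_to h t \<and> Q \<gamma>}"
    using bij_betw_layer_paths_to[OF assms] by (auto simp: bij_betw_def inj_on_def)
  from sum.reindex_bij_betw[OF this, of "path_weight (\<lambda>h t. a (h + t)) (\<lambda>h t. 1)", symmetric]
  show ?thesis by (simp add: path_weight_layer)
qed

lemma layer_weight_nonneg: "(\<And>j. a j > 0) \<Longrightarrow> layer_weight a n A \<ge> 0"
  unfolding layer_weight_def by (intro prod_nonneg) (auto intro: less_imp_le)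

section \<open>Comparison of neighbouring layers\<close>

text \<open>Turning the vertical step at time \<open>j\<close> into a horizontal one is a bijection
  that removes exactly the factor \<open>a j\<close> from the weight.\<close>

lemma layer_weight_flip:
  assumes "j < n"
  shows "(\<Sum>A | A \<in> layer n h \<and> j \<notin> A. layer_weight a n A) =
    a j * (\<Sum>A | A \<in> layer n (Suc h) \<and> j \<in> A. layer_weight a n A)"
proof -
  have "bij_betw (insert j) {A \<in> layer n h. j \<notin> A} {A \<in> layer n (Suc h). j \<in> A}"
  proof (rule bij_betw_byWitness[where f' = "\<lambda>A. A - {j}"])
    show "insert j ` {A \<in> layer n h. j \<notin> A} \<subseteq> {A \<in> layer n (Suc h). j \<in> A}"
      using assms by (auto simp: layer_def card_insert_if finite_subset)
    show "(\<lambda>A. A - {j}) ` {A \<in> layer n (Suc h). j \<in> A} \<subseteq> {A \<in> layer n h. j \<notin> A}"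
      by (auto simp: layer_def)
  qed auto
  from sum.reindex_bij_betw[OF this, symmetric]
  have "a j * (\<Sum>A | A \<in> layer n (Suc h) \<and> j \<in> A. layer_weight a n A) =
    (\<Sum>A | A \<in> layer n h \<and> j \<notin> A. a j * layer_weight a n (insert j A))"
    by (simp add: sum_distrib_left)
  also have "\<dots> = (\<Sum>A | A \<in> layer n h \<and> j \<notin> A. layer_weight a n A)"
  proof (intro sum.cong refl)
    fix A assume "A \<in> {A. A \<in> layer n h \<and> j \<notin> A}"
    then have "layer_weight a n A = (\<Prod>i\<in>insert j ({..<n} - insert j A). a i)"
      unfolding layer_weight_def using assms by (intro prod.cong) auto
    also have "\<dots> = a j * layer_weight a n (insert j A)"
      by (simp add: layer_weight_def)
    finally show "a j * layer_weight a n (insert j A) = layer_weight a n A" ..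
  qed
  finally show ?thesis ..
qed

text \<open>Double counting of the pairs of a set \<open>A\<close> and an index \<open>j\<close>
  with \<open>P j A\<close>.\<close>

lemma sum_card_Int_eq:
  assumes "finite F" "finite J"
  shows "(\<Sum>A\<in>F. f A * real (card {j \<in> J. P j A})) = (\<Sum>j\<in>J. \<Sum>A | A \<in> F \<and> P j A. f A)"
proof -
  have "(\<Sum>A\<in>F. f A * real (card {j \<in> J. P j A})) = (\<Sum>A\<in>F. \<Sum>j\<in>J. if P j A then f A else 0)"
    using assms by (simp add: sum.If_cases Int_def mult.commute)
  also have "\<dots> = (\<Sum>j\<in>J. \<Sum>A | A \<in> F \<and> P j A. f A)"
    using assms by (subst sum.swap) (simp add: sum.inter_filter)
  finally show ?thesis .
qed

lemma L_M_set: "finite (L_set a n)" "finite (M_set a n)" "L_set a n \<inter> M_set a n = {}" 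
  "L_set a n \<union> M_set a n = {..<n}"
  by (auto simp: L_set_def M_set_def)

lemma card_L_M_set: "card (L_set a n) + card (M_set a n) = n"
  using card_Un_disjoint[of "L_set a n" "M_set a n"] L_M_set[of a n] by simp

text \<open>If \<open>card A = h + 1\<close>, then \<open>A\<close> contains at least \<open>h + 1 - card (M_set a n)\<close> elements of
  \<open>L_set a n\<close>. Summing over these elements and removing one of them from \<open>A\<close> compares the two layers.
  The left tail exchanges the roles of \<open>L_set\<close> and \<open>M_set\<close>.\<close>

lemma layer_weight_right_tail:
  assumes pos: "\<And>j. a j > 0"
  shows "(real (Suc h) - real (card (M_set a n))) * (\<Sum>A\<in>layer n (Suc h). layer_weight a n A)
    \<le> (\<Sum>j\<in>L_set a n. 1 / a j) * (\<Sum>A\<in>layer n h. layer_weight a n A)"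
proof -
  have "(real (Suc h) - real (card (M_set a n))) * (\<Sum>A\<in>layer n (Suc h). layer_weight a n A)
    \<le> (\<Sum>A\<in>layer n (Suc h). layer_weight a n A * real (card {j \<in> L_set a n. j \<in> A}))"
    unfolding sum_distrib_left
  proof (rule sum_mono)
    fix A assume A: "A \<in> layer n (Suc h)"
    then have "A \<subseteq> {j \<in> L_set a n. j \<in> A} \<union> M_set a n" using L_M_set(4)[of a n] by (auto simp: layer_def)
    then have "card A \<le> card {j \<in> L_set a n. j \<in> A} + card (M_set a n)"
      using L_M_set(1,2)[of a n] by (intro order_trans[OF card_mono card_Un_le]) auto
    then have "real (Suc h) - real (card (M_set a n)) \<le> real (card {j \<in> L_set a n. j \<in> A})"
      using A by (simp add: layer_def)
    then show "(real (Suc h) - real (card (M_set a n))) * layer_weight a n A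
        \<le> layer_weight a n A * real (card {j \<in> L_set a n. j \<in> A})"
      using layer_weight_nonneg[of a n A] pos by (simp add: mult.commute mult_left_mono)
  qed
  also have "\<dots> = (\<Sum>j\<in>L_set a n. \<Sum>A | A \<in> layer n (Suc h) \<and> j \<in> A. layer_weight a n A)"
    by (intro sum_card_Int_eq) (simp_all add: L_M_set)
  also have "\<dots> \<le> (\<Sum>j\<in>L_set a n. 1 / a j * (\<Sum>A\<in>layer n h. layer_weight a n A))"
  proof (rule sum_mono)
    fix j assume "j \<in> L_set a n"
    then have j: "j < n" by (simp add: L_set_def)
    have "(\<Sum>A | A \<in> layer n h \<and> j \<notin> A. layer_weight a n A) \<le> (\<Sum>A\<in>layer n h. layer_weight a n A)"
      using pos by (intro sum_mono2) (auto intro: layer_weight_nonneg)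
    then show "(\<Sum>A | A \<in> layer n (Suc h) \<and> j \<in> A. layer_weight a n A)
      \<le> 1 / a j * (\<Sum>A\<in>layer n h. layer_weight a n A)"
      using pos[of j] unfolding layer_weight_flip[OF j] by (simp add: field_simps)
  qed
  finally show ?thesis by (simp add: sum_distrib_right)
qed

lemma layer_weight_left_tail:
  assumes pos: "\<And>j. a j > 0"
  shows "(real (card (M_set a n)) - real h) * (\<Sum>A\<in>layer n h. layer_weight a n A)
    \<le> (\<Sum>j\<in>M_set a n. a j) * (\<Sum>A\<in>layer n (Suc h). layer_weight a n A)"
proof -
  have "(real (card (M_set a n)) - real h) * (\<Sum>A\<in>layer n h. layer_weight a n A)
    \<le> (\<Sum>A\<in>layer n h. layer_weight a n A * real (card {j \<in> M_set a n. j \<notin> A}))"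
    unfolding sum_distrib_left
  proof (rule sum_mono)
    fix A assume A: "A \<in> layer n h"
    then have "finite A" by (auto simp: layer_def finite_subset)
    have "M_set a n \<subseteq> {j \<in> M_set a n. j \<notin> A} \<union> A" by auto
    then have "card (M_set a n) \<le> card {j \<in> M_set a n. j \<notin> A} + card A"
      using L_M_set(1,2)[of a n] \<open>finite A\<close>
      by (intro order_trans[OF card_mono card_Un_le]) auto
    then have "real (card (M_set a n)) - real h \<le> real (card {j \<in> M_set a n. j \<notin> A})"
      using A by (simp add: layer_def)
    then show "(real (card (M_set a n)) - real h) * layer_weight a n A
        \<le> layer_weight a n A * real (card {j \<in> M_set a n. j \<notin> A})"
      using layer_weight_nonneg[of a n A] pos by (simp add: mult.commute mult_left_mono)
  qed
  also have "\<dots> = (\<Sum>j\<in>M_set a n. \<Sum>A | A \<in> layer n h \<and> j \<notin> A. layer_weight a n A)"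
    by (intro sum_card_Int_eq) (simp_all add: L_M_set)
  also have "\<dots> \<le> (\<Sum>j\<in>M_set a n. a j * (\<Sum>A\<in>layer n (Suc h). layer_weight a n A))"
  proof (rule sum_mono)
    fix j assume "j \<in> M_set a n"
    then have j: "j < n" by (simp add: M_set_def)
    have "(\<Sum>A | A \<in> layer n (Suc h) \<and> j \<in> A. layer_weight a n A) \<le> (\<Sum>A\<in>layer n (Suc h). layer_weight a n A)"
      using pos by (intro sum_mono2) (auto intro: layer_weight_nonneg)
    then show "(\<Sum>A | A \<in> layer n h \<and> j \<notin> A. layer_weight a n A)
      \<le> a j * (\<Sum>A\<in>layer n (Suc h). layer_weight a n A)"
      using pos[of j] unfolding layer_weight_flip[OF j] by (simp add: mult_left_mono)
  qed
  finally show ?thesis by (simp add: sum_distrib_right)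
qed

text \<open>Flipping the vertical step at \<open>j\<close> leads into layer \<open>h + 1\<close>,
  whose total weight is controlled by that of layer \<open>h\<close> through the right tail bound.
  Thus a vertical step at \<open>j\<close> has a small share of the layer once \<open>h\<close> is
  far above \<open>card (M_set a n)\<close>.\<close>

lemma layer_weight_missing_step:
  assumes pos: "\<And>j. a j > 0" and j: "j < n" and h: "card (M_set a n) \<le> h"
  shows "(real (Suc h) - real (card (M_set a n))) * (\<Sum>A | A \<in> layer n h \<and> j \<notin> A. layer_weight a n A)
    \<le> a j * (\<Sum>j\<in>L_set a n. 1 / a j) * (\<Sum>A\<in>layer n h. layer_weight a n A)"
proof -
  have "(\<Sum>A | A \<in> layer n (Suc h) \<and> j \<in> A. layer_weight a n A) \<le> (\<Sum>A\<in>layer n (Suc h). layer_weight a n A)"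
    using pos by (intro sum_mono2) (auto intro: layer_weight_nonneg)
  then have "(real (Suc h) - real (card (M_set a n))) * (\<Sum>A | A \<in> layer n h \<and> j \<notin> A. layer_weight a n A)
    \<le> a j * ((real (Suc h) - real (card (M_set a n))) * (\<Sum>A\<in>layer n (Suc h). layer_weight a n A))"
    using h pos[of j] unfolding layer_weight_flip[OF j] by (simp add: mult.left_commute mult_left_mono)
  also have "\<dots> \<le> a j * ((\<Sum>j\<in>L_set a n. 1 / a j) * (\<Sum>A\<in>layer n h. layer_weight a n A))"
    using layer_weight_right_tail[OF pos] pos[of j] by (intro mult_left_mono) auto
  finally show ?thesis by (simp add: mult.assoc)
qed

text \<open>Mirror image of the previous bound: flipping the horizontal step at \<open>j\<close>
  leads into layer \<open>h - 1\<close>, which the left tail bound compares with layer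
  \<open>h\<close>.\<close>

lemma layer_weight_present_step:
  assumes pos: "\<And>j. a j > 0" and j: "j < n" and h: "h \<le> card (M_set a n)"
  shows "(real (card (M_set a n)) + 1 - real h) * (\<Sum>A | A \<in> layer n h \<and> j \<in> A. layer_weight a n A)
    \<le> 1 / a j * (\<Sum>j\<in>M_set a n. a j) * (\<Sum>A\<in>layer n h. layer_weight a n A)"
proof (cases h)
  case 0
  \<comment> \<open>There is no layer below \<open>h = 0\<close>, but also no horizontal step to
    flip.\<close>
  then have empty: "{A. A \<in> layer n h \<and> j \<in> A} = {}" by (auto simp: layer_def finite_subset)
  have "1 / a j * (\<Sum>j\<in>M_set a n. a j) * (\<Sum>A\<in>layer n h. layer_weight a n A) \<ge> 0"
    using pos by (intro mult_nonneg_nonneg sum_nonneg layer_weight_nonneg) (auto intro: less_imp_le)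
  then show ?thesis unfolding empty by simp
next
  case (Suc k)
  let ?c = "real (card (M_set a n)) - real k"
  have "(\<Sum>A | A \<in> layer n k \<and> j \<notin> A. layer_weight a n A) \<le> (\<Sum>A\<in>layer n k. layer_weight a n A)"
    using pos by (intro sum_mono2) (auto intro: layer_weight_nonneg)
  then have "?c * (a j * (\<Sum>A | A \<in> layer n h \<and> j \<in> A. layer_weight a n A))
      \<le> ?c * (\<Sum>A\<in>layer n k. layer_weight a n A)"
    using h Suc unfolding Suc layer_weight_flip[OF j] by (intro mult_left_mono) auto
  also have "\<dots> \<le> (\<Sum>j\<in>M_set a n. a j) * (\<Sum>A\<in>layer n h. layer_weight a n A)"
    using layer_weight_left_tail[OF pos] Suc by simp
  finally have "?c * (\<Sum>A | A \<in> layer n h \<and> j \<in> A. layer_weight a n A)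
      \<le> (\<Sum>j\<in>M_set a n. a j) * (\<Sum>A\<in>layer n h. layer_weight a n A) / a j"
    using pos[of j] by (simp add: field_simps)
  \<comment> \<open>Since \<open>h = Suc k\<close>, the factor \<open>?c\<close> equals
    \<open>card (M_set a n) + 1 - h\<close>.\<close>
  then show ?thesis using Suc by (simp add: algebra_simps)
qed

section \<open>Bounds uniform in \<open>n\<close> from summability\<close>

lemma prob_h_le_prob_t_iff: "a j > 0 \<Longrightarrow> prob_h a j \<le> prob_t a j \<longleftrightarrow> 1 \<le> a j"
  unfolding prob_h_def prob_t_def by (subst divide_le_cancel) auto

text \<open>On \<open>L_set\<close> one has \<open>a j\<close> at least 1, hence
  \<open>1 + a j\<close> is at most \<open>2 * a j\<close>, and \<open>1 / a j\<close> is at most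
  four times the term of the convergent series.\<close>

lemma sum_L_set_le:
  assumes pos: "\<And>j. a j > 0" and sum: "summable (\<lambda>n. a n / (1 + a n)\<^sup>2)"
  shows "(\<Sum>j\<in>L_set a n. 1 / a j) \<le> 4 * (\<Sum>n. a n / (1 + a n)\<^sup>2)"
proof -
  have "(\<Sum>j\<in>L_set a n. 1 / a j) \<le> (\<Sum>j\<in>L_set a n. 4 * (a j / (1 + a j)\<^sup>2))"
  proof (rule sum_mono)
    fix j assume "j \<in> L_set a n"
    then have "1 \<le> a j" using pos by (simp add: L_set_def prob_h_le_prob_t_iff)
    then have "(1 + a j)\<^sup>2 \<le> (2 * a j)\<^sup>2" by (intro power_mono) auto
    then show "1 / a j \<le> 4 * (a j / (1 + a j)\<^sup>2)"
      using pos[of j] by (simp add: divide_simps power2_eq_square)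
  qed
  also have "\<dots> = 4 * (\<Sum>j\<in>L_set a n. a j / (1 + a j)\<^sup>2)" by (simp add: sum_distrib_left)
  also have "\<dots> \<le> 4 * (\<Sum>n. a n / (1 + a n)\<^sup>2)"
    using pos by (intro mult_left_mono sum_le_suminf sum) (auto simp: L_M_set less_imp_le)
  finally show ?thesis .
qed

text \<open>On \<open>M_set\<close> one has \<open>a j\<close> at most 1, hence
  \<open>1 + a j\<close> is at most 2, and \<open>a j\<close> is at most four times the term of the
  series.\<close>

lemma sum_M_set_le:
  assumes pos: "\<And>j. a j > 0" and sum: "summable (\<lambda>n. a n / (1 + a n)\<^sup>2)"
  shows "(\<Sum>j\<in>M_set a n. a j) \<le> 4 * (\<Sum>n. a n / (1 + a n)\<^sup>2)"
proof -
  have "(\<Sum>j\<in>M_set a n. a j) \<le> (\<Sum>j\<in>M_set a n. 4 * (a j / (1 + a j)\<^sup>2))"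
  proof (rule sum_mono)
    fix j assume "j \<in> M_set a n"
    then have "a j \<le> 1" using pos by (simp add: M_set_def prob_h_le_prob_t_iff flip: not_le)
    then have "(1 + a j)\<^sup>2 \<le> 2\<^sup>2" using pos[of j] by (intro power_mono) auto
    then show "a j \<le> 4 * (a j / (1 + a j)\<^sup>2)"
      using pos[of j] by (simp add: divide_simps)
  qed
  also have "\<dots> = 4 * (\<Sum>j\<in>M_set a n. a j / (1 + a j)\<^sup>2)" by (simp add: sum_distrib_left)
  also have "\<dots> \<le> 4 * (\<Sum>n. a n / (1 + a n)\<^sup>2)"
    using pos by (intro mult_left_mono sum_le_suminf sum) (auto simp: L_M_set less_imp_le)
  finally show ?thesis .
qed


section \<open>Laws of paths\<close>

lemma space_path_space: "space path_space = Collect standard_path"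
  by (simp add: path_space_def space_restrict_space space_PiM)

section \<open>Limits of probabilities of events\<close>

text \<open>Dominated convergence, since almost surely the indicators eventually equal that of the
  limit event.\<close>

lemma (in prob_space) prob_tendsto:
  assumes [measurable]: "\<And>n. Measurable.pred M (Q n)" "Measurable.pred M R"
    and ae: "AE x in M. \<forall>\<^sub>F n in sequentially. Q n x \<longleftrightarrow> R x"
  shows "(\<lambda>n::nat. prob {x \<in> space M. Q n x}) \<longlonglongrightarrow> prob {x \<in> space M. R x}"
proof -
  have "(\<lambda>n. \<integral>x. indicator {x \<in> space M. Q n x} x \<partial>M) \<longlonglongrightarrow> (\<integral>x. indicator {x \<in> space M. R x} x \<partial>M :: real)"
  proof (rule integral_dominated_convergence[where w = "\<lambda>_. 1"])
    from ae show "AE x in M. (\<lambda>n. indicator {x \<in> space M. Q n x} x) \<longlonglongrightarrow> (indicator {x \<in> space M. R x} x :: real)"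
    proof eventually_elim
      case (elim x)
      show ?case by (rule tendsto_eventually, rule eventually_mono[OF elim]) (simp add: indicator_def)
    qed
  qed (auto simp: indicator_def)
  then show ?thesis by (simp add: Int_def cong: conj_cong)
qed

text \<open>For fixed \<open>K\<close>, letting \<open>n\<close> tend to infinity removes the
  condition \<open>U K n\<close>, which almost surely holds eventually; then \<open>K\<close> tends
  to infinity. The order of the two limits requires that \<open>c\<close> depend on neither
  \<open>n\<close> nor \<open>K\<close>.\<close>

lemma (in prob_space) AE_not_if_prob_bounds:
  fixes c :: real
  assumes [measurable]: "Measurable.pred M Q" "\<And>n K. Measurable.pred M (U K n)"
    and le: "\<And>K n. n > n0 \<Longrightarrow> prob {x \<in> space M. Q x \<and> U K n x} \<le> c / real (Suc K)"
    and ae: "\<And>K. AE x in M. \<forall>\<^sub>F n::nat in sequentially. U K n x"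
  shows "AE x in M. \<not> Q x"
proof -
  have "prob {x \<in> space M. Q x} \<le> c / real (Suc K)" for K
  proof (rule LIMSEQ_le_const2)
    show "(\<lambda>n. prob {x \<in> space M. Q x \<and> U K n x}) \<longlonglongrightarrow> prob {x \<in> space M. Q x}"
    proof (rule prob_tendsto)
      show "AE x in M. \<forall>\<^sub>F n in sequentially. (Q x \<and> U K n x) = Q x"
        using ae[of K] by eventually_elim (erule eventually_mono, simp)
    qed measurable
    show "\<exists>N. \<forall>n\<ge>N. prob {x \<in> space M. Q x \<and> U K n x} \<le> c / real (Suc K)"
      using le by (intro exI[of _ "Suc n0"]) auto
  qed
  moreover have "(\<lambda>K. c / real (Suc K)) \<longlonglongrightarrow> 0"
    using tendsto_mult[OF tendsto_const[of c] LIMSEQ_inverse_real_of_nat] by (simp add: divide_inverse)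
  ultimately have "prob {x \<in> space M. Q x} \<le> 0" by (intro LIMSEQ_le_const) auto
  then have "prob {x \<in> space M. Q x} = 0" by (simp add: measure_le_0_iff)
  then show ?thesis by (subst (asm) prob_eq_0) (auto simp: AE_conj_iff)
qed

section \<open>Measurability on path space and uniqueness of laws\<close>

locale path_law = prob_space P for P :: "(nat \<Rightarrow> nat \<times> nat) measure" +
  assumes sets_eq: "sets P = sets path_space"
begin

lemma space_eq: "space P = Collect standard_path"
  using sets_eq_imp_space_eq[OF sets_eq] by (simp add: space_path_space)

lemma measurable_at [measurable]: "(\<lambda>S. S n) \<in> measurable P (count_space UNIV)"
proof -
  have "(\<lambda>S. S n) \<in> measurable path_space (count_space UNIV)"
    unfolding path_space_def
    by (intro measurable_restrict_space1 measurable_component_singleton UNIV_I)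
  then show ?thesis using measurable_cong_sets[OF sets_eq refl] by blast
qed

lemma measurable_history [measurable]: "history n \<in> measurable P (count_space UNIV)"
proof (subst measurable_count_space_eq2_countable, intro conjI ballI)
  fix \<gamma> :: "(nat \<times> nat) list"
  have "history n -` {\<gamma>} \<inter> space P = {S \<in> space P. length \<gamma> = Suc n \<and> (\<forall>i\<in>{..n}. S i = \<gamma> ! i)}"
    by (auto simp: history_eq_iff)
  also have "\<dots> \<in> sets P" by measurable
  finally show "history n -` {\<gamma>} \<inter> space P \<in> sets P" .
qed auto

lemma pred_at: "Measurable.pred P (\<lambda>S. Q (S n))"
  by (rule measurable_compose[OF measurable_at]) simp

lemma pred_history: "Measurable.pred P (\<lambda>S. Q (history n S))"
  by (rule measurable_compose[OF measurable_history]) simp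

end

text \<open>Histories determine the finite-dimensional cylinders, these determine a finite measure
  on the product space, and the measurable sets of \<open>path_space\<close> are traces of product
  sets.\<close>

lemma path_law_eqI:
  assumes "path_law P" "path_law P'"
    and eq: "\<And>n S. standard_path S \<Longrightarrow>
      measure P {S' \<in> space P. history n S' = history n S} = measure P' {S' \<in> space P'. history n S' = history n S}"
  shows "P = P'"
proof -
  interpret P: path_law P by fact
  interpret P': path_law P' by fact
  have vimage_Int_space: "f -` A \<inter> space Q = {S \<in> space Q. f S \<in> A}"
    for f :: "(nat \<Rightarrow> nat \<times> nat) \<Rightarrow> 'b" and A Q by auto
  \<comment> \<open>Lists of vertices form a countable type, so agreement on single histories gives
    agreement on every set of histories.\<close>
  have hist: "emeasure P {S \<in> space P. X (history n S)} = emeasure P' {S \<in> space P'. X (history n S)}" for n X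
  proof -
    have "distr P (count_space UNIV) (history n) = distr P' (count_space UNIV) (history n)"
    proof (rule measure_eqI_countable)
      fix \<gamma> :: "(nat \<times> nat) list"
      have "measure P {S' \<in> space P. history n S' = \<gamma>} = measure P' {S' \<in> space P'. history n S' = \<gamma>}"
      proof (cases "\<exists>S. standard_path S \<and> history n S = \<gamma>")
        case False
        then have "{S' \<in> space P. history n S' = \<gamma>} = {}" "{S' \<in> space P'. history n S' = \<gamma>} = {}"
          unfolding P.space_eq P'.space_eq by auto
        then show ?thesis by (simp only: measure_empty)
      qed (use eq in auto)
      then show "emeasure (distr P (count_space UNIV) (history n)) {\<gamma>} =
          emeasure (distr P' (count_space UNIV) (history n)) {\<gamma>}"
        by (simp add: emeasure_distr vimage_Int_space P.emeasure_eq_measure P'.emeasure_eq_measure)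
    qed auto
    from arg_cong[OF this, of "\<lambda>M. emeasure M {\<gamma>. X \<gamma>}"] show ?thesis
      by (simp add: emeasure_distr Int_def conj_commute)
  qed
  let ?N = "\<Pi>\<^sub>M n\<in>(UNIV::nat set). count_space (UNIV :: (nat \<times> nat) set)"
  have id: "(\<lambda>S. S) \<in> measurable Q ?N" if "path_law Q" for Q
  proof -
    interpret Q: path_law Q by fact
    show ?thesis by (intro measurable_PiM_single') auto
  qed
  have eq: "distr P ?N (\<lambda>S. S) = distr P' ?N (\<lambda>S. S)"
  proof (rule measure_eqI_PiM_infinite[where I = UNIV and M = "\<lambda>_. count_space UNIV"])
    fix J :: "nat set" and F :: "nat \<Rightarrow> (nat \<times> nat) set" assume J: "finite J"
    then have "\<exists>n. \<forall>j\<in>J. j \<le> n" using finite_nat_set_iff_bounded_le by auto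
    then obtain n where n: "\<And>j. j \<in> J \<Longrightarrow> j \<le> n" by auto
    \<comment> \<open>A cylinder over the finite set \<open>J\<close> is an event about the history
      up to a common bound \<open>n\<close> of \<open>J\<close>.\<close>
    have "prod_emb UNIV (\<lambda>_. count_space UNIV) J (Pi\<^sub>E J F) \<inter> A = {S \<in> A. \<forall>j\<in>J. history n S ! j \<in> F j}" for A
      using n by (auto simp: prod_emb_def PiE_iff)
    then show "emeasure (distr P ?N (\<lambda>S. S)) (prod_emb UNIV (\<lambda>_. count_space UNIV) J (Pi\<^sub>E J F)) =
        emeasure (distr P' ?N (\<lambda>S. S)) (prod_emb UNIV (\<lambda>_. count_space UNIV) J (Pi\<^sub>E J F))"
      using hist[of "\<lambda>\<gamma>. \<forall>j\<in>J. \<gamma> ! j \<in> F j" n] J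
      by (simp add: emeasure_distr id assms(1,2) sets_PiM_I)
  next
    show "finite_measure (distr P ?N (\<lambda>S. S))"
      by (rule P.finite_measure_distr[OF id[OF assms(1)]])
  qed auto
  show ?thesis
  proof (rule measure_eqI)
    fix A assume "A \<in> sets P"
    then obtain B where B: "B \<in> sets ?N" "A = Collect standard_path \<inter> B"
      unfolding P.sets_eq path_space_def sets_restrict_space by blast
    show "emeasure P A = emeasure P' A"
      using arg_cong[OF eq, of "\<lambda>M. emeasure M B"] B
      by (simp add: emeasure_distr id assms(1,2) P.space_eq P'.space_eq Int_commute)
  qed (simp add: P.sets_eq P'.sets_eq)
qed

section \<open>The conditioning property and events independent of the past\<close>

text \<open>Given \<open>S n\<close>, the event \<open>R\<close> does not influence the conditional law of the path up to time \<open>n\<close>;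
  for trivial \<open>R\<close> this is the conditioning property that defines \<open>path_laws\<close>.\<close>

definition past_indep ::
  "(nat \<Rightarrow> nat \<Rightarrow> real) \<Rightarrow> (nat \<Rightarrow> nat \<Rightarrow> real) \<Rightarrow> (nat \<Rightarrow> nat \<times> nat) measure \<Rightarrow> nat \<Rightarrow>
    ((nat \<Rightarrow> nat \<times> nat) \<Rightarrow> bool) \<Rightarrow> bool" where
  "past_indep w0 w1 P n R \<longleftrightarrow> (\<forall>h t \<gamma>. h + t = n \<longrightarrow> \<gamma> \<in> paths_to h t \<longrightarrow>
     \<P>(S in P. R S \<and> history n S = \<gamma>) =
       path_weight w0 w1 \<gamma> / path_dim w0 w1 h t * \<P>(S in P. R S \<and> S n = (h, t)))"

lemma last_paths_to: "\<gamma> \<in> paths_to h t \<Longrightarrow> last \<gamma> = (h, t)"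
  by (simp add: paths_to_def)

lemma history_in_paths_to_iff:
  "standard_path S \<Longrightarrow> h + t = n \<Longrightarrow> history n S \<in> paths_to h t \<longleftrightarrow> S n = (h, t)"
  using history_in_paths_to last_paths_to last_history by metis

lemma (in path_law) prob_history_sum:
  assumes [measurable]: "Measurable.pred P R" and n: "h + t = n"
  shows "prob {S \<in> space P. R S \<and> S n = (h, t) \<and> X (history n S)} =
    (\<Sum>\<gamma> | \<gamma> \<in> paths_to h t \<and> X \<gamma>. prob {S \<in> space P. R S \<and> history n S = \<gamma>})"
proof -
  have "{S \<in> space P. R S \<and> S n = (h, t) \<and> X (history n S)} =
      (\<Union>\<gamma>\<in>{\<gamma>. \<gamma> \<in> paths_to h t \<and> X \<gamma>}. {S \<in> space P. R S \<and> history n S = \<gamma>})"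
    using n history_in_paths_to_iff unfolding space_eq by auto
  also have "prob \<dots> = (\<Sum>\<gamma> | \<gamma> \<in> paths_to h t \<and> X \<gamma>. prob {S \<in> space P. R S \<and> history n S = \<gamma>})"
    by (rule finite_measure_finite_Union) (auto simp: disjoint_family_on_def finite_paths_to)
  finally show ?thesis .
qed

text \<open>Where the endpoint has positive probability, the product formula is the conditional
  probability multiplied out; where it has probability zero, both sides of the formula
  vanish.\<close>

lemma path_laws_iff:
  "P \<in> path_laws w0 w1 \<longleftrightarrow> path_law P \<and> (\<forall>n. past_indep w0 w1 P n (\<lambda>_. True))"
proof (cases "path_law P")
  case True
  interpret path_law P by fact
  have "(prob {S \<in> space P. S n = (h, t)} > 0 \<longrightarrow>
      \<P>(S in P. history n S = \<gamma> \<bar> S n = (h, t)) = path_weight w0 w1 \<gamma> / path_dim w0 w1 h t) \<longleftrightarrow>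
    prob {S \<in> space P. history n S = \<gamma>} =
      path_weight w0 w1 \<gamma> / path_dim w0 w1 h t * prob {S \<in> space P. S n = (h, t)}"
    if "h + t = n" "\<gamma> \<in> paths_to h t" for n h t \<gamma>
  proof -
    have *: "history n S = \<gamma> \<and> S n = (h, t) \<longleftrightarrow> history n S = \<gamma>" for S
      using that last_history[of n S] last_paths_to by metis
    show ?thesis
    proof (cases "prob {S \<in> space P. S n = (h, t)} = 0")
      case True
      have "prob {S \<in> space P. history n S = \<gamma>} \<le> prob {S \<in> space P. S n = (h, t)}"
        using * by (intro finite_measure_mono) auto
      with True show ?thesis by (simp add: measure_le_0_iff)
    next
      case False
      then show ?thesis unfolding cond_prob_def * by (simp add: field_simps zero_less_measure_iff)
    qed
  qed
  moreover have "prob_space P" by unfold_locales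
  ultimately show ?thesis
    using True sets_eq unfolding path_laws_def past_indep_def history_def by simp blast
next
  case False
  then show ?thesis by (auto simp: path_laws_def path_law_def path_law_axioms_def)
qed

locale conditioned_law = path_law P for P +
  fixes w0 w1 :: "nat \<Rightarrow> nat \<Rightarrow> real"
  assumes w0_pos: "w0 h t > 0" and w1_pos: "w1 h t > 0"
    and indep_True: "past_indep w0 w1 P n (\<lambda>_. True)"
begin

abbreviation "w \<equiv> path_weight w0 w1"
abbreviation "d \<equiv> path_dim w0 w1"
abbreviation "ind \<equiv> past_indep w0 w1 P"

lemma d_pos: "d h t > 0" and w_pos: "w \<gamma> > 0"
  using path_dim_pos path_weight_pos w0_pos w1_pos by blast+

lemma past_indepD:
  "ind n R \<Longrightarrow> \<gamma> \<in> paths_to h t \<Longrightarrow> h + t = n \<Longrightarrow>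
    prob {S \<in> space P. R S \<and> history n S = \<gamma>} = w \<gamma> / d h t * prob {S \<in> space P. R S \<and> S n = (h, t)}"
  by (auto simp: past_indep_def)

lemma prob_past:
  assumes [measurable]: "Measurable.pred P R" and n: "h + t = n" and ind: "ind n R"
  shows "prob {S \<in> space P. R S \<and> S n = (h, t) \<and> X (history n S)} =
    (\<Sum>\<gamma> | \<gamma> \<in> paths_to h t \<and> X \<gamma>. w \<gamma>) / d h t * prob {S \<in> space P. R S \<and> S n = (h, t)}"
  unfolding prob_history_sum[OF assms(1) n]
  using past_indepD[OF ind _ n] by (simp add: sum_divide_distrib sum_distrib_right)

text \<open>Splitting by the next vertex, the weight of either extension of \<gamma> is
  \<open>w \<gamma>\<close> times an edge weight that depends on the endpoint only. So the
  probability is \<open>w \<gamma>\<close> times a constant \<open>K\<close> of the endpoint, and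
  summing over all paths to \<open>(h, t)\<close> identifies \<open>K\<close>.\<close>

lemma past_indep_step:
  assumes [measurable]: "Measurable.pred P R" and ind: "ind (Suc n) R"
  shows "ind n R"
  unfolding past_indep_def
proof (intro allI impI)
  fix h t \<gamma> assume n: "h + t = n" and \<gamma>: "\<gamma> \<in> paths_to h t"
  define K where "K = w1 h t / d (Suc h) t * prob {S \<in> space P. R S \<and> S (Suc n) = (Suc h, t)}
    + w0 h t / d h (Suc t) * prob {S \<in> space P. R S \<and> S (Suc n) = (h, Suc t)}"
  have *: "prob {S \<in> space P. R S \<and> history n S = \<gamma>} = w \<gamma> * K" if \<gamma>: "\<gamma> \<in> paths_to h t" for \<gamma>
  proof -
    obtain S0 where S0: "standard_path S0" "\<gamma> = history n S0" "S0 n = (h, t)"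
      using paths_to_history[OF \<gamma>] n by metis
    have ext: "\<gamma> @ [v] \<in> paths_to (fst v) (snd v)" if "v = (Suc h, t) \<or> v = (h, Suc t)" for v
    proof -
      have len: "length \<gamma> = Suc n" using length_paths_to[OF \<gamma>] n by simp
      have "finite_standard_path (\<gamma> @ [v])"
        unfolding finite_standard_path_def
      proof (intro conjI allI impI)
        show "hd (\<gamma> @ [v]) = (0, 0)" using \<gamma> by (auto simp: paths_to_def finite_standard_path_def)
        fix i assume i: "Suc i < length (\<gamma> @ [v])"
        show "lattice_edge ((\<gamma> @ [v]) ! i) ((\<gamma> @ [v]) ! Suc i)"
        proof (cases "i = n")
          case True
          then show ?thesis using that len S0 by (auto simp: nth_append lattice_edge_def)
        next
          case False
          then show ?thesis using i len \<gamma>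
            by (auto simp: nth_append paths_to_def finite_standard_path_def)
        qed
      qed simp
      then show ?thesis by (simp add: paths_to_def)
    qed
    have "{S \<in> space P. R S \<and> history n S = \<gamma>} = {S \<in> space P. R S \<and> history (Suc n) S = \<gamma> @ [(Suc h, t)]}
      \<union> {S \<in> space P. R S \<and> history (Suc n) S = \<gamma> @ [(h, Suc t)]}" (is "_ = ?A \<union> ?B")
    proof -
      have "S (Suc n) = (Suc h, t) \<or> S (Suc n) = (h, Suc t)" if "standard_path S" "history n S = \<gamma>" for S
      proof -
        have "S n = (h, t)" using that last_history[of n S] last_paths_to[OF \<gamma>] by simp
        then show ?thesis using standard_path_Suc[OF that(1), of n] by auto
      qed
      then show ?thesis unfolding history_Suc space_eq by auto
    qed
    also have "prob \<dots> = prob ?A + prob ?B"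
      by (rule finite_measure_Union) auto
    finally have split: "prob {S \<in> space P. R S \<and> history n S = \<gamma>} = prob ?A + prob ?B" .
    have A: "prob ?A = w (\<gamma> @ [(Suc h, t)]) / d (Suc h) t * prob {S \<in> space P. R S \<and> S (Suc n) = (Suc h, t)}"
      using ext[of "(Suc h, t)"] n by (intro past_indepD[OF ind]) simp_all
    have B: "prob ?B = w (\<gamma> @ [(h, Suc t)]) / d h (Suc t) * prob {S \<in> space P. R S \<and> S (Suc n) = (h, Suc t)}"
      using ext[of "(h, Suc t)"] n by (intro past_indepD[OF ind]) simp_all
    have "\<gamma> \<noteq> []" using S0 by (simp add: history_def)
    then have "w (\<gamma> @ [(Suc h, t)]) = w \<gamma> * w1 h t" "w (\<gamma> @ [(h, Suc t)]) = w \<gamma> * w0 h t"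
      using last_paths_to[OF \<gamma>] by (simp_all add: path_weight_snoc edge_weight_def)
    then show ?thesis unfolding split A B by (simp add: K_def algebra_simps)
  qed
  have "prob {S \<in> space P. R S \<and> S n = (h, t)} = d h t * K"
    using prob_history_sum[OF assms(1) n, of "\<lambda>_. True"]
    by (simp add: * path_dim_def sum_distrib_right)
  then show "prob {S \<in> space P. R S \<and> history n S = \<gamma>} = w \<gamma> / d h t * prob {S \<in> space P. R S \<and> S n = (h, t)}"
    using *[OF \<gamma>] d_pos[of h t] by simp
qed

lemma past_indep_antimono:
  assumes "Measurable.pred P R" "ind n R" "m \<le> n"
  shows "ind m R"
  using assms(3,2) by (induction rule: inc_induct) (auto intro: past_indep_step[OF assms(1)])

text \<open>On both events in question \<open>S n = (h, t)\<close>, so the condition on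
  \<open>S n\<close> is either always or never satisfied.\<close>

lemma past_indep_at:
  assumes ind: "ind n R"
  shows "ind n (\<lambda>S. R S \<and> S n \<in> G)"
  unfolding past_indep_def
proof (intro allI impI)
  fix h t \<gamma> assume n: "h + t = n" and \<gamma>: "\<gamma> \<in> paths_to h t"
  have *: "S n = (h, t)" if "history n S = \<gamma>" for S
    using that last_history[of n S] last_paths_to[OF \<gamma>] by simp
  show "prob {S \<in> space P. (R S \<and> S n \<in> G) \<and> history n S = \<gamma>} =
      w \<gamma> / d h t * prob {S \<in> space P. (R S \<and> S n \<in> G) \<and> S n = (h, t)}"
  proof (cases "(h, t) \<in> G")
    case True
    then have "{S \<in> space P. (R S \<and> S n \<in> G) \<and> history n S = \<gamma>} = {S \<in> space P. R S \<and> history n S = \<gamma>}"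
      "{S \<in> space P. (R S \<and> S n \<in> G) \<and> S n = (h, t)} = {S \<in> space P. R S \<and> S n = (h, t)}"
      using * by auto
    then show ?thesis using past_indepD[OF ind \<gamma> n] by simp
  next
    case False
    then have "{S \<in> space P. (R S \<and> S n \<in> G) \<and> history n S = \<gamma>} = {}"
      "{S \<in> space P. (R S \<and> S n \<in> G) \<and> S n = (h, t)} = {}"
      using * by auto
    then show ?thesis by (simp only: measure_empty mult_zero_right)
  qed
qed

text \<open>The identity for \<open>R\<close> is subtracted from the one for the sure event.\<close>

lemma past_indep_not:
  assumes [measurable]: "Measurable.pred P R" and ind: "ind n R"
  shows "ind n (\<lambda>S. \<not> R S)"
  unfolding past_indep_def
proof (intro allI impI)
  fix h t \<gamma> assume n: "h + t = n" and \<gamma>: "\<gamma> \<in> paths_to h t"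
  have *: "prob {S \<in> space P. \<not> R S \<and> Q S} = prob {S \<in> space P. True \<and> Q S} - prob {S \<in> space P. R S \<and> Q S}"
    if [measurable]: "Measurable.pred P Q" for Q
    by (subst finite_measure_Diff[symmetric]) (auto intro!: arg_cong[where f = prob])
  show "prob {S \<in> space P. \<not> R S \<and> history n S = \<gamma>} =
      w \<gamma> / d h t * prob {S \<in> space P. \<not> R S \<and> S n = (h, t)}"
    by (subst (1 2) *, measurable)
       (use past_indepD[OF ind \<gamma> n] past_indepD[OF indep_True \<gamma> n] in \<open>simp add: algebra_simps\<close>)
qed

text \<open>Both sides of the defining identity pass to the limit, the weight quotient being
  constant in \<open>i\<close>.\<close>

lemma past_indep_tendsto:
  assumes [measurable]: "\<And>i. Measurable.pred P (R i)" "Measurable.pred P R'"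
    and ae: "AE S in P. \<forall>\<^sub>F i in sequentially. R i S \<longleftrightarrow> R' S"
    and ind: "\<forall>\<^sub>F i::nat in sequentially. ind n (R i)"
  shows "ind n R'"
  unfolding past_indep_def
proof (intro allI impI)
  fix h t \<gamma> assume n: "h + t = n" and \<gamma>: "\<gamma> \<in> paths_to h t"
  have lim: "(\<lambda>i. prob {S \<in> space P. R i S \<and> Q S}) \<longlonglongrightarrow> prob {S \<in> space P. R' S \<and> Q S}"
    if [measurable]: "Measurable.pred P Q" for Q
  proof (rule prob_tendsto)
    show "AE S in P. \<forall>\<^sub>F i in sequentially. (R i S \<and> Q S) \<longleftrightarrow> (R' S \<and> Q S)"
      using ae by eventually_elim (erule eventually_mono, auto)
  qed auto
  show "prob {S \<in> space P. R' S \<and> history n S = \<gamma>} = w \<gamma> / d h t * prob {S \<in> space P. R' S \<and> S n = (h, t)}"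
  proof (rule LIMSEQ_unique)
    show "(\<lambda>i. prob {S \<in> space P. R i S \<and> history n S = \<gamma>}) \<longlonglongrightarrow> prob {S \<in> space P. R' S \<and> history n S = \<gamma>}"
      by (rule lim) auto
    have "(\<lambda>i. w \<gamma> / d h t * prob {S \<in> space P. R i S \<and> S n = (h, t)}) \<longlonglongrightarrow>
        w \<gamma> / d h t * prob {S \<in> space P. R' S \<and> S n = (h, t)}"
      by (intro tendsto_mult_left lim) auto
    then show "(\<lambda>i. prob {S \<in> space P. R i S \<and> history n S = \<gamma>}) \<longlonglongrightarrow>
        w \<gamma> / d h t * prob {S \<in> space P. R' S \<and> S n = (h, t)}"
      by (rule Lim_transform_eventually)
         (rule eventually_mono[OF ind], simp add: past_indepD[OF _ \<gamma> n])
  qed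
qed

lemma pred_all_ge: "Measurable.pred P (\<lambda>S. \<forall>m\<ge>k. S m \<in> G m)"
  by measurable

text \<open>The window is peeled off at its left end: the constraints from \<open>k + 1\<close> on
  are independent of the past at \<open>k + 1\<close>, hence at \<open>k\<close>, and the constraint
  at \<open>k\<close> concerns the present.\<close>

lemma past_indep_all_between: "ind k (\<lambda>S. \<forall>m. k \<le> m \<and> m \<le> k + N \<longrightarrow> S m \<in> G m)"
proof (induction N arbitrary: k)
  case 0
  have "ind k (\<lambda>S. True \<and> S k \<in> G k)" by (intro past_indep_at indep_True)
  moreover have "(k \<le> m \<and> m \<le> k) = (m = k)" for m by auto
  ultimately show ?case by simp
next
  case (Suc N)
  have "ind k (\<lambda>S. (\<forall>m. Suc k \<le> m \<and> m \<le> Suc k + N \<longrightarrow> S m \<in> G m) \<and> S k \<in> G k)"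
    by (rule past_indep_at, rule past_indep_step[OF _ Suc]) measurable
  moreover have "(\<forall>m. k \<le> m \<and> m \<le> k + Suc N \<longrightarrow> S m \<in> G m) \<longleftrightarrow>
      (\<forall>m. Suc k \<le> m \<and> m \<le> Suc k + N \<longrightarrow> S m \<in> G m) \<and> S k \<in> G k" for S :: "nat \<Rightarrow> nat \<times> nat"
    by (auto simp: Suc_le_eq) (metis le_neq_implies_less)
  ultimately show ?case by simp
qed

lemma past_indep_all_ge: "ind k (\<lambda>S. \<forall>m\<ge>k. S m \<in> G m)"
proof (rule past_indep_tendsto[where R = "\<lambda>N S. \<forall>m. k \<le> m \<and> m \<le> k + N \<longrightarrow> S m \<in> G m"])
  show "AE S in P. \<forall>\<^sub>F N in sequentially.
      (\<forall>m. k \<le> m \<and> m \<le> k + N \<longrightarrow> S m \<in> G m) \<longleftrightarrow> (\<forall>m\<ge>k. S m \<in> G m)"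
  proof (intro AE_I2)
    fix S
    show "\<forall>\<^sub>F N in sequentially. (\<forall>m. k \<le> m \<and> m \<le> k + N \<longrightarrow> S m \<in> G m) \<longleftrightarrow> (\<forall>m\<ge>k. S m \<in> G m)"
    proof (cases "\<forall>m\<ge>k. S m \<in> G m")
      case False
      then obtain m where "m \<ge> k" "S m \<notin> G m" by auto
      then show ?thesis by (intro eventually_sequentiallyI[of m]) force
    qed simp
  qed
qed (measurable, simp add: past_indep_all_between)

text \<open>The event is the limit of the events that the constraint holds from \<open>k\<close> on,
  and these are independent of the past at every \<open>n\<close> up to \<open>k\<close>.\<close>

lemma past_indep_eventually: "ind n (\<lambda>S. \<forall>\<^sub>F m in sequentially. S m \<in> G m)"
proof (rule past_indep_tendsto[where R = "\<lambda>k S. \<forall>m\<ge>k. S m \<in> G m"])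
  show "AE S in P. \<forall>\<^sub>F k in sequentially. (\<forall>m\<ge>k. S m \<in> G m) \<longleftrightarrow> (\<forall>\<^sub>F m in sequentially. S m \<in> G m)"
  proof (intro AE_I2)
    fix S
    show "\<forall>\<^sub>F k in sequentially. (\<forall>m\<ge>k. S m \<in> G m) \<longleftrightarrow> (\<forall>\<^sub>F m in sequentially. S m \<in> G m)"
    proof (cases "\<forall>\<^sub>F m in sequentially. S m \<in> G m")
      case True
      then obtain k where "\<forall>m\<ge>k. S m \<in> G m" by (auto simp: eventually_sequentially)
      with True show ?thesis by (intro eventually_sequentiallyI[of k]) auto
    next
      case False
      then have "\<not> (\<forall>m\<ge>k. S m \<in> G m)" for k by (auto simp: eventually_sequentially)
      with False show ?thesis by simp
    qed
  qed
  show "\<forall>\<^sub>F k in sequentially. ind n (\<lambda>S. \<forall>m\<ge>k. S m \<in> G m)"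
    by (intro eventually_sequentiallyI[of n] past_indep_antimono[OF _ past_indep_all_ge]) measurable
qed (measurable, simp add: eventually_sequentially)

section \<open>Conditioning and extremality\<close>

text \<open>Dividing the identity for \<open>R\<close> by the probability of \<open>R\<close> gives
  the conditioning property of the conditional law.\<close>

lemma uniform_measure_in_path_laws:
  assumes [measurable]: "Measurable.pred P R" and ind: "\<And>n. ind n R"
    and pos: "prob {S \<in> space P. R S} > 0"
  shows "uniform_measure P {S \<in> space P. R S} \<in> path_laws w0 w1"
proof -
  let ?A = "{S \<in> space P. R S}"
  let ?U = "uniform_measure P ?A"
  have e: "emeasure P ?A \<noteq> 0" "emeasure P ?A \<noteq> \<infinity>" using pos by (auto simp: emeasure_eq_measure)
  interpret U: path_law ?U
    by (intro path_law.intro prob_space_uniform_measure path_law_axioms.intro e) (simp add: sets_eq)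
  have U: "measure ?U {S \<in> space ?U. Q S} = prob {S \<in> space P. R S \<and> Q S} / prob ?A"
    if [measurable]: "Measurable.pred P Q" for Q
    using e by (subst measure_uniform_measure) (auto intro!: arg_cong2[where f = "(/)"] arg_cong[where f = prob])
  have "past_indep w0 w1 ?U n (\<lambda>_. True)" for n
    unfolding past_indep_def
  proof (intro allI impI)
    fix h t \<gamma> assume n: "h + t = n" and \<gamma>: "\<gamma> \<in> paths_to h t"
    show "measure ?U {S \<in> space ?U. True \<and> history n S = \<gamma>} =
        w \<gamma> / d h t * measure ?U {S \<in> space ?U. True \<and> S n = (h, t)}"
      by (subst (1 2) U, measurable) (simp add: past_indepD[OF ind \<gamma> n])
  qed
  then show ?thesis
    unfolding path_laws_iff using U.path_law_axioms by blast
qed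

text \<open>Otherwise \<open>P\<close> is a proper mixture of its conditional laws on
  \<open>R\<close> and on the complement, both in the class. Extremality identifies the first with
  \<open>P\<close>, which gives \<open>R\<close> probability 1.\<close>

lemma extreme_imp_tail_trivial:
  assumes [measurable]: "Measurable.pred P R" and ind: "\<And>n. ind n R"
    and ext: "P \<in> extreme_laws (path_laws w0 w1)"
  shows "prob {S \<in> space P. R S} = 0 \<or> prob {S \<in> space P. R S} = 1"
proof (rule ccontr)
  let ?A = "{S \<in> space P. R S}" and ?B = "{S \<in> space P. \<not> R S}"
  assume "\<not> ?thesis"
  then have A: "0 < prob ?A" "prob ?A < 1" by (auto simp: zero_less_measure_iff less_le)
  have B: "prob ?B = 1 - prob ?A" by (rule prob_neg) measurable
  have e: "emeasure P ?A \<noteq> 0" "emeasure P ?A \<noteq> \<infinity>" "emeasure P ?B \<noteq> 0" "emeasure P ?B \<noteq> \<infinity>"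
    using A B by (auto simp: emeasure_eq_measure)
  let ?P1 = "uniform_measure P ?A" and ?P2 = "uniform_measure P ?B"
  have "?P1 \<in> path_laws w0 w1"
    by (rule uniform_measure_in_path_laws) (use ind A in auto)
  moreover have "?P2 \<in> path_laws w0 w1"
    by (rule uniform_measure_in_path_laws) (use past_indep_not[OF _ ind] A B in auto)
  moreover have "prob E = prob ?A * measure ?P1 E + (1 - prob ?A) * measure ?P2 E" if [measurable]: "E \<in> sets P" for E
  proof -
    have "prob E = prob ((?A \<inter> E) \<union> (?B \<inter> E))"
      using sets.sets_into_space[OF that] by (intro arg_cong[where f = prob]) auto
    also have "\<dots> = prob (?A \<inter> E) + prob (?B \<inter> E)" by (rule finite_measure_Union) auto
    finally show ?thesis
      using A B e by (simp add: measure_uniform_measure)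
  qed
  ultimately have "?P1 = P"
    using ext A unfolding extreme_laws_def by blast
  then have "prob ?A = measure ?P1 ?A" by simp
  also have "\<dots> = 1" using e A by (simp add: measure_uniform_measure)
  finally show False using A by simp
qed

end

text \<open>A proper mixture gives \<open>A\<close> mass 1 only if both components do. Hence an
  event of mass 1 that singles out \<open>P\<close> within \<open>C\<close> makes \<open>P\<close>
  extreme.\<close>

lemma extreme_lawsI:
  assumes P: "P \<in> C" and C: "\<And>P'. P' \<in> C \<Longrightarrow> prob_space P'"
    and A: "A \<in> sets P" "measure P A = 1"
    and unique: "\<And>P'. P' \<in> C \<Longrightarrow> measure P' A = 1 \<Longrightarrow> P' = P"
  shows "P \<in> extreme_laws C"
  unfolding extreme_laws_def
proof (intro CollectI conjI ballI allI impI P)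
  fix P1 P2 and u :: real
  assume P12: "P1 \<in> C" "P2 \<in> C"
    and u: "0 < u \<and> u < 1 \<and> (\<forall>A\<in>sets P. measure P A = u * measure P1 A + (1 - u) * measure P2 A)"
  have le: "measure P1 A \<le> 1" "measure P2 A \<le> 1" using P12 C prob_space.prob_le_1 by blast+
  have "1 = u * measure P1 A + (1 - u) * measure P2 A" using u A by auto
  then have "u * (1 - measure P1 A) + (1 - u) * (1 - measure P2 A) = 0" by (simp add: algebra_simps)
  moreover have "u * (1 - measure P1 A) \<ge> 0" "(1 - u) * (1 - measure P2 A) \<ge> 0"
    using u le by auto
  ultimately have "u * (1 - measure P1 A) = 0" "(1 - u) * (1 - measure P2 A) = 0" by linarith+
  then have "measure P1 A = 1" "measure P2 A = 1" using u by auto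
  then show "P1 = P" "P2 = P" using unique P12 by blast+
qed


section \<open>The law with independent increments\<close>

lemma path_law_P_star: "path_law (P_star a)"
  by (intro path_law.intro path_law_axioms.intro prob_space_P_star) (simp add: P_star_def)

lemma prob_P_star_history:
  assumes pos: "\<And>n. a n > 0"
  shows "\<P>(S in P_star a. history n S = history n (path_of_steps \<omega>)) =
    (\<Prod>j<n. if \<omega> j then prob_h a j else prob_t a j)"
proof -
  let ?p = "\<lambda>n. measure_pmf (bernoulli_pmf (prob_h a n))"
  interpret product_prob_space ?p UNIV by standard
  interpret S: path_law "P_star a" by (rule path_law_P_star)
  have p: "prob_h a j \<in> {0..1}" "1 - prob_h a j = prob_t a j" for j
    using pos[of j] by (auto simp: prob_h_def prob_t_def field_simps)
  have "{S \<in> space (P_star a). history n S = history n (path_of_steps \<omega>)} \<in> sets (P_star a)"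
    by measurable
  then have meas: "{S \<in> space (P_star a). history n S = history n (path_of_steps \<omega>)} \<in> sets path_space"
    by (simp add: S.sets_eq)
  have "\<P>(S in P_star a. history n S = history n (path_of_steps \<omega>)) =
      measure (PiM UNIV ?p) (path_of_steps -` {S \<in> space (P_star a). history n S = history n (path_of_steps \<omega>)}
        \<inter> space (PiM UNIV ?p))"
    using meas unfolding P_star_def by (intro measure_distr measurable_path_of_steps) simp
  also have "path_of_steps -` {S \<in> space (P_star a). history n S = history n (path_of_steps \<omega>)} \<inter> space (PiM UNIV ?p) =
      {\<omega>' \<in> space (PiM UNIV ?p). \<forall>j\<in>{..<n}. \<omega>' j \<in> {\<omega> j}}"
    by (auto simp: S.space_eq standard_path_of_steps history_path_of_steps_eq_iff)
  also have "measure (PiM UNIV ?p) \<dots> = (\<Prod>j<n. measure (?p j) {\<omega> j})"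
  proof -
    have "emeasure (PiM UNIV ?p) {\<omega>' \<in> space (PiM UNIV ?p). \<forall>j\<in>{..<n}. \<omega>' j \<in> {\<omega> j}}
        = (\<Prod>j<n. emeasure (?p j) {\<omega> j})"
      by (rule emeasure_PiM_Collect) auto
    then show ?thesis
      by (simp add: emeasure_eq_measure measure_pmf.emeasure_eq_measure prod_ennreal prod_nonneg)
  qed
  also have "\<dots> = (\<Prod>j<n. if \<omega> j then prob_h a j else prob_t a j)"
    using p by (intro prod.cong refl) (simp add: measure_pmf_single)
  finally show ?thesis .
qed

text \<open>Since \<open>prob_t a j = prob_h a j * a j\<close>, the product of the step
  probabilities is the path weight times a factor that depends on the length only.\<close>

lemma prob_P_star_history_eq_weight:
  assumes pos: "\<And>n. a n > 0" and \<gamma>: "\<gamma> \<in> paths_to h t"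
  shows "\<P>(S in P_star a. history (h + t) S = \<gamma>) =
    (\<Prod>j<h + t. prob_h a j) * path_weight (\<lambda>h t. a (h + t)) (\<lambda>h t. 1) \<gamma>"
proof -
  obtain \<omega> where \<omega>: "\<gamma> = history (h + t) (path_of_steps \<omega>)" using paths_to_steps[OF \<gamma>] by metis
  show ?thesis
    unfolding \<omega> prob_P_star_history[OF pos] path_weight_path_of_steps prod.distrib[symmetric]
    by (intro prod.cong refl) (simp add: prob_h_def prob_t_def)
qed

text \<open>The factor common to all paths of one length cancels between the path and its
  endpoint.\<close>

lemma conditioned_law_P_star:
  assumes pos: "\<And>n. a n > 0"
  shows "conditioned_law (P_star a) (\<lambda>h t. a (h + t)) (\<lambda>h t. 1)"
proof -
  interpret path_law "P_star a" by (rule path_law_P_star)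
  have sum: "prob {S \<in> space (P_star a). S (h + t) = (h, t)} =
      (\<Prod>j<h + t. prob_h a j) * path_dim (\<lambda>h t. a (h + t)) (\<lambda>h t. 1) h t" for h t
    using prob_history_sum[of "\<lambda>_. True" h t "h + t" "\<lambda>_. True"]
    by (simp add: prob_P_star_history_eq_weight[OF pos] path_dim_def sum_distrib_left)
  have "path_dim (\<lambda>h t. a (h + t)) (\<lambda>h t. 1) h t > 0" for h t
    using pos by (intro path_dim_pos) auto
  note d = less_imp_neq[OF this, symmetric]
  show ?thesis
  proof
    show "past_indep (\<lambda>h t. a (h + t)) (\<lambda>h t. 1) (P_star a) n (\<lambda>_. True)" for n
      unfolding past_indep_def
      by (auto simp: prob_P_star_history_eq_weight[OF pos] sum d)
  qed (use pos in auto)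
qed

section \<open>Displacement and its limit\<close>

text \<open>\<open>True\<close> means that the more probable step at \<open>j\<close> is horizontal;
  a tie counts as vertical, in accordance with \<open>L_set\<close> and
  \<open>M_set\<close>.\<close>

definition typical_step :: "(nat \<Rightarrow> real) \<Rightarrow> nat \<Rightarrow> bool" where
  "typical_step a j \<longleftrightarrow> prob_t a j < prob_h a j"

text \<open>First coordinate of the centred path; on standard paths the second coordinate is its
  negative.\<close>

definition displacement :: "(nat \<Rightarrow> real) \<Rightarrow> nat \<Rightarrow> (nat \<Rightarrow> nat \<times> nat) \<Rightarrow> int" where
  "displacement a n S = int (fst (S n)) - int (card (M_set a n))"

text \<open>Convergence of an integer sequence means being eventually constant, so this says that
  the displacement converges to \<open>z\<close>.\<close>

definition settles :: "(nat \<Rightarrow> real) \<Rightarrow> int \<Rightarrow> (nat \<Rightarrow> nat \<times> nat) \<Rightarrow> bool" where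
  "settles a z S \<longleftrightarrow> (\<forall>\<^sub>F n in sequentially. displacement a n S = z)"

lemma card_M_set_Suc: "card (M_set a (Suc n)) = card (M_set a n) + (if typical_step a n then 1 else 0)"
proof -
  have "M_set a (Suc n) = (if typical_step a n then insert n (M_set a n) else M_set a n)"
    by (auto simp: M_set_def typical_step_def less_Suc_eq)
  then show ?thesis by (auto simp: M_set_def)
qed

text \<open>The displacement moves only at atypical steps, and then by one up or down. Hence it
  freezes once all steps are typical, and it cannot jump over a level.\<close>

lemma displacement_Suc:
  assumes "standard_path S"
  shows "displacement a (Suc n) S = displacement a n S + (if steps_of S n then 1 else 0)
    - (if typical_step a n then 1 else 0)"
  using standard_path_Suc[OF assms, of n] by (simp add: displacement_def card_M_set_Suc)

lemma displacement_eq_if_typical: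
  assumes "standard_path S" "\<And>m. m \<ge> n \<Longrightarrow> steps_of S m = typical_step a m" "m \<ge> n"
  shows "displacement a m S = displacement a n S"
  using assms(3) by (induction rule: dec_induct) (use assms in \<open>simp_all add: displacement_Suc\<close>)

lemma settles_unique: "settles a z S \<Longrightarrow> settles a z' S \<Longrightarrow> z = z'"
  unfolding settles_def using eventually_happens'[OF sequentially_bot eventually_conj] by fastforce

text \<open>The coordinates of \<open>S n\<close> and the cardinalities of \<open>M_set\<close> and
  \<open>L_set\<close> both add up to \<open>n\<close>, so the pair is the displacement and its
  negative.\<close>

lemma limit_iff_settles:
  assumes S: "standard_path S"
  shows "(\<lambda>n. (int (fst (S n)) - int (card (M_set a n)), int (snd (S n)) - int (card (L_set a n))))
    \<longlonglongrightarrow> (z, - z) \<longleftrightarrow> settles a z S"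
proof -
  have "int (snd (S n)) - int (card (L_set a n)) = - displacement a n S" for n
    using standard_path_sum[OF S, of n] card_L_M_set[of a n] by (simp add: displacement_def)
  then have *: "(\<lambda>n. (int (fst (S n)) - int (card (M_set a n)), int (snd (S n)) - int (card (L_set a n)))) =
      (\<lambda>n. (displacement a n S, - displacement a n S))"
    by (simp add: displacement_def)
  show ?thesis
  proof
    assume "(\<lambda>n. (int (fst (S n)) - int (card (M_set a n)), int (snd (S n)) - int (card (L_set a n)))) \<longlonglongrightarrow> (z, - z)"
    from tendsto_fst[OF this[unfolded *]] show "settles a z S"
      by (simp add: tendsto_discrete settles_def)
  next
    assume "settles a z S"
    then show "(\<lambda>n. (int (fst (S n)) - int (card (M_set a n)), int (snd (S n)) - int (card (L_set a n)))) \<longlonglongrightarrow> (z, - z)"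
      unfolding * settles_def by (intro tendsto_eventually) (auto elim: eventually_mono)
  qed
qed

text \<open>Where the limit does not exist, \<open>Z_lim\<close> takes the junk value \<open>THE z. False\<close>.\<close>

lemma Z_lim_eq_iff:
  assumes "standard_path S"
  shows "Z_lim a S = z \<longleftrightarrow> settles a z S \<or> (\<forall>z'. \<not> settles a z' S) \<and> z = (THE z. False)"
proof (cases "\<exists>z'. settles a z' S")
  case True
  then obtain z' where z': "settles a z' S" by auto
  then have "Z_lim a S = z'"
    unfolding Z_lim_def limit_iff_settles[OF assms] by (intro the_equality) (auto dest: settles_unique)
  then show ?thesis using z' settles_unique by blast
next
  case False
  then show ?thesis unfolding Z_lim_def limit_iff_settles[OF assms] by auto
qed

lemma (in path_law) pred_displacement [measurable]:
  "Measurable.pred P (\<lambda>S. displacement a n S = z)"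
  unfolding displacement_def by (rule pred_at[where Q = "\<lambda>v. int (fst v) - _ = z"])

lemma (in path_law) pred_displacement_less [measurable]:
  "Measurable.pred P (\<lambda>S. displacement a n S > z)" "Measurable.pred P (\<lambda>S. displacement a n S < z)"
  unfolding displacement_def
  by (rule pred_at[where Q = "\<lambda>v. int (fst v) - _ > z"], rule pred_at[where Q = "\<lambda>v. int (fst v) - _ < z"])

lemma (in path_law) pred_settles [measurable]: "Measurable.pred P (\<lambda>S. settles a z S)"
  unfolding settles_def eventually_sequentially by measurable

lemma (in path_law) pred_steps_of [measurable]: "Measurable.pred P (\<lambda>S. steps_of S n)"
proof -
  have "steps_of S n \<longleftrightarrow> fst (history (Suc n) S ! Suc n) = Suc (fst (history (Suc n) S ! n))" for S
    by (simp add: steps_of_def)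
  then show ?thesis using pred_history by simp
qed

section \<open>Eventual constancy and atoms under \<open>P_star\<close>\<close>

text \<open>The Weierstrass product inequality, by induction on the index set.\<close>

lemma prod_one_minus_ge:
  fixes f :: "nat \<Rightarrow> real"
  assumes f: "\<And>j. 0 \<le> f j" "\<And>j. f j \<le> 1"
  shows "1 - (\<Sum>j\<in>A. f j) \<le> (\<Prod>j\<in>A. 1 - f j)"
proof (induction A rule: infinite_finite_induct)
  case (insert x A)
  have "(\<Prod>j\<in>A. 1 - f j) \<le> 1" using f by (intro prod_le_1) auto
  then have "f x * (\<Prod>j\<in>A. 1 - f j) \<le> f x * 1" using f by (intro mult_left_mono) auto
  then show ?case using insert by (simp add: algebra_simps)
qed simp_all

locale summable_weights =
  fixes a :: "nat \<Rightarrow> real"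
  assumes pos: "a n > 0"
    and sum: "summable (\<lambda>n. a n / (1 + a n)\<^sup>2)"
begin

sublocale PS: conditioned_law "P_star a" "\<lambda>h t. a (h + t)" "\<lambda>h t. 1"
  by (rule conditioned_law_P_star) (rule pos)

text \<open>The smaller of the two step probabilities.\<close>

definition atypical_prob :: "nat \<Rightarrow> real" where
  "atypical_prob n = (if typical_step a n then prob_t a n else prob_h a n)"

lemma atypical_prob_nonneg: "0 \<le> atypical_prob n" and atypical_prob_le_1: "atypical_prob n \<le> 1"
  using pos[of n] by (auto simp: atypical_prob_def prob_h_def prob_t_def)

text \<open>The quotient \<open>a n / (1 + a n)^2\<close> is the product of the two step
  probabilities, of which the larger is at least one half.\<close>

lemma atypical_prob_le: "atypical_prob n \<le> 2 * (a n / (1 + a n)\<^sup>2)"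
proof -
  have frac: "x / (1 + a n) = x * (1 + a n) / (1 + a n)\<^sup>2" for x
    using pos[of n] by (simp add: power2_eq_square)
  have le: "x * (1 + a n) / (1 + a n)\<^sup>2 \<le> 2 * a n / (1 + a n)\<^sup>2" if "x * (1 + a n) \<le> 2 * a n" for x
    using that by (rule divide_right_mono) simp
  have "a n * (1 + a n) \<le> 2 * a n" if "typical_step a n"
  proof -
    have "a n \<le> 1"
      using that prob_h_le_prob_t_iff[of a n] pos[of n] by (simp add: typical_step_def flip: not_le)
    then show ?thesis using pos[of n] by (simp add: mult_left_mono mult.commute)
  qed
  moreover have "1 * (1 + a n) \<le> 2 * a n" if "\<not> typical_step a n"
    using that prob_h_le_prob_t_iff[of a n] pos[of n] by (simp add: typical_step_def)
  ultimately show ?thesis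
    unfolding atypical_prob_def prob_h_def prob_t_def frac[of "a n"] frac[of 1]
    using le[of "a n"] le[of 1] by simp
qed

lemma summable_atypical_prob: "summable atypical_prob"
  by (rule summable_comparison_test'[OF summable_mult[OF sum, of 2], of 0])
     (use atypical_prob_nonneg atypical_prob_le in \<open>simp add: abs_of_nonneg\<close>)

lemma prob_atypical:
  "\<P>(S in P_star a. steps_of S n \<noteq> typical_step a n) = atypical_prob n"
proof -
  have "steps_of S n \<longleftrightarrow> increment n S = (1, 0)" "\<not> steps_of S n \<longleftrightarrow> increment n S = (0, 1)"
    if "standard_path S" for S
    using standard_path_Suc[OF that, of n] by (auto simp: increment_def)
  then have "{S \<in> space (P_star a). steps_of S n \<noteq> typical_step a n} =
      {S \<in> space (P_star a). increment n S = (if typical_step a n then (0, 1) else (1, 0))}"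
    unfolding PS.space_eq by auto
  then show ?thesis
    using P_star_increment_h[where a = a and n = n] P_star_increment_t[where a = a and n = n] pos[of n] by (simp add: atypical_prob_def)
qed

lemma AE_eventually_typical: "AE S in P_star a. \<forall>\<^sub>F n in sequentially. steps_of S n = typical_step a n"
proof -
  have "AE S in P_star a. \<forall>\<^sub>F n in sequentially.
      S \<in> space (P_star a) - {S \<in> space (P_star a). steps_of S n \<noteq> typical_step a n}"
  proof (rule borel_cantelli_AE1)
    show "summable (\<lambda>n. \<P>(S in P_star a. steps_of S n \<noteq> typical_step a n))"
      unfolding prob_atypical by (rule summable_atypical_prob)
  qed (auto simp: PS.emeasure_eq_measure)
  then show ?thesis by eventually_elim (erule eventually_mono, auto)
qed

text \<open>Almost surely only finitely many steps are atypical, and the displacement is constant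
  after the last of them.\<close>

lemma AE_settles: "AE S in P_star a. \<exists>z. settles a z S"
proof -
  have "AE S in P_star a. standard_path S" by (rule AE_I2) (simp add: PS.space_eq)
  with AE_eventually_typical show ?thesis
  proof eventually_elim
    case (elim S)
    then obtain n where "\<And>m. m \<ge> n \<Longrightarrow> steps_of S m = typical_step a m" by (auto simp: eventually_sequentially)
    then have "settles a (displacement a n S) S"
      unfolding settles_def
      by (intro eventually_sequentiallyI[of n] displacement_eq_if_typical) (use elim in auto)
    then show ?case by blast
  qed
qed

text \<open>A path that is typical from some time on is an atom of \<open>P_star\<close>: its finite
  histories have product probabilities, and the factors beyond a late time multiply to at least
  1/2.\<close>

lemma prob_path_pos:
  assumes typical: "\<And>j. j \<ge> n0 \<Longrightarrow> \<omega> j = typical_step a j"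
  shows "\<P>(S in P_star a. S = path_of_steps \<omega>) > 0"
proof -
  let ?s = "\<lambda>j. if \<omega> j then prob_h a j else prob_t a j"
  have s_pos: "?s j > 0" for j using pos[of j] by (simp add: prob_h_def prob_t_def)
  \<comment> \<open>The Cauchy criterion makes the tail sums small; the maximum with
    \<open>n0\<close> starts the tail where \<open>\<omega>\<close> is already typical.\<close>
  obtain n1 where n1: "\<And>k. \<bar>sum atypical_prob {max n0 n1..<k}\<bar> < 1 / 2"
  proof -
    obtain N where "\<forall>m\<ge>N. \<forall>k. norm (sum atypical_prob {m..<k}) < 1 / 2"
      using summable_atypical_prob unfolding summable_Cauchy by (metis half_gt_zero zero_less_one)
    then show thesis by (intro that[of N]) simp
  qed
  define n where "n = max n0 n1"
  define c where "c = (\<Prod>j<n. ?s j) * (1 / 2)"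
  have c: "c > 0" unfolding c_def using s_pos by (simp add: prod_pos)
  have ge: "c \<le> \<P>(S in P_star a. history N S = history N (path_of_steps \<omega>))" if N: "N \<ge> n" for N
  proof -
    have "1 / 2 \<le> 1 - (\<Sum>j\<in>{n..<N}. atypical_prob j)" using n1[of N] by (simp add: n_def abs_less_iff)
    also have "\<dots> \<le> (\<Prod>j\<in>{n..<N}. 1 - atypical_prob j)"
      by (intro prod_one_minus_ge atypical_prob_nonneg atypical_prob_le_1)
    also have "\<dots> = (\<Prod>j\<in>{n..<N}. ?s j)"
    proof (intro prod.cong refl)
      fix j assume "j \<in> {n..<N}"
      then have "\<omega> j = typical_step a j" using typical by (simp add: n_def)
      then show "1 - atypical_prob j = ?s j"
        using pos[of j] by (simp add: atypical_prob_def prob_h_def prob_t_def field_simps)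
    qed
    finally have "c \<le> (\<Prod>j<n. ?s j) * (\<Prod>j\<in>{n..<N}. ?s j)"
      unfolding c_def by (intro mult_left_mono prod_nonneg ballI less_imp_le[OF s_pos])
    also have "\<dots> = (\<Prod>j<N. ?s j)"
      using N prod.atLeastLessThan_concat[of 0 n N ?s] by (simp add: atLeast0LessThan)
    finally show ?thesis by (simp add: prob_P_star_history[OF pos])
  qed
  have eq: "S = path_of_steps \<omega> \<longleftrightarrow> (\<forall>N. history N S = history N (path_of_steps \<omega>))" for S
    unfolding history_cong_iff by (auto intro!: ext)
  have "(\<lambda>N. \<P>(S in P_star a. history N S = history N (path_of_steps \<omega>)))
      \<longlonglongrightarrow> \<P>(S in P_star a. S = path_of_steps \<omega>)"
  proof (rule PS.prob_tendsto)
    show "Measurable.pred (P_star a) (\<lambda>S. S = path_of_steps \<omega>)" unfolding eq by measurable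
    show "AE S in P_star a. \<forall>\<^sub>F N in sequentially.
        (history N S = history N (path_of_steps \<omega>)) = (S = path_of_steps \<omega>)"
    proof (intro AE_I2)
      fix S
      show "\<forall>\<^sub>F N in sequentially. (history N S = history N (path_of_steps \<omega>)) = (S = path_of_steps \<omega>)"
      proof (cases "S = path_of_steps \<omega>")
        case False
        then obtain N where "S N \<noteq> path_of_steps \<omega> N" by blast
        then show ?thesis using False by (intro eventually_sequentiallyI[of N]) (auto simp: history_cong_iff)
      qed simp
    qed
  qed measurable
  then have "c \<le> \<P>(S in P_star a. S = path_of_steps \<omega>)"
    by (rule LIMSEQ_le_const) (use ge in blast)
  with c show ?thesis by linarith
qed

text \<open>Following \<open>S\<close> up to time \<open>n\<close> and taking typical steps
  afterwards gives an atom whose displacement stays at \<open>z\<close>. So every level that some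
  path attains belongs to the range of the limit.\<close>

lemma prob_settles_pos:
  assumes S: "standard_path S" "displacement a n S = z"
  shows "\<P>(S in P_star a. settles a z S) > 0"
proof -
  define \<omega> where "\<omega> j = (if j < n then steps_of S j else typical_step a j)" for j
  have "path_of_steps \<omega> n = path_of_steps (steps_of S) n"
    by (rule path_of_steps_cong) (simp add: \<omega>_def)
  then have "displacement a n (path_of_steps \<omega>) = z"
    using S by (simp add: displacement_def path_of_steps_steps_of)
  moreover have "displacement a m (path_of_steps \<omega>) = displacement a n (path_of_steps \<omega>)" if "m \<ge> n" for m
    using that by (intro displacement_eq_if_typical standard_path_of_steps) (auto simp: \<omega>_def)
  ultimately have "\<forall>m\<ge>n. displacement a m (path_of_steps \<omega>) = z" by metis
  then have "settles a z (path_of_steps \<omega>)"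
    unfolding settles_def eventually_sequentially by blast
  then have "\<P>(S in P_star a. S = path_of_steps \<omega>) \<le> \<P>(S in P_star a. settles a z S)"
    by (intro PS.finite_measure_mono) auto
  moreover have "\<P>(S in P_star a. S = path_of_steps \<omega>) > 0"
    by (rule prob_path_pos[of n]) (simp add: \<omega>_def)
  ultimately show ?thesis by linarith
qed

lemma pred_Z_lim: "Measurable.pred (P_star a) (\<lambda>S. Z_lim a S = z)"
proof -
  have "Measurable.pred (P_star a)
      (\<lambda>S. settles a z S \<or> (\<forall>z'. \<not> settles a z' S) \<and> z = (THE z. False))"
    by measurable
  then show ?thesis
    by (rule measurable_cong[THEN iffD2, rotated]) (simp add: PS.space_eq Z_lim_eq_iff)
qed

text \<open>The limit exists almost surely, so the default value of \<open>Z_lim\<close> matters on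
  a null set only.\<close>

lemma AE_Z_lim: "AE S in P_star a. Z_lim a S = z \<longleftrightarrow> settles a z S"
proof -
  have "AE S in P_star a. standard_path S" by (rule AE_I2) (simp add: PS.space_eq)
  with AE_settles show ?thesis by eventually_elim (auto simp: Z_lim_eq_iff)
qed

lemma mem_Z_range_iff: "z \<in> Z_range a \<longleftrightarrow> \<P>(S in P_star a. settles a z S) > 0"
proof -
  have "\<P>(S in P_star a. Z_lim a S = z) = \<P>(S in P_star a. settles a z S)"
    using AE_Z_lim pred_Z_lim by (intro PS.prob_eq_AE) auto
  then show ?thesis by (simp add: Z_range_def)
qed

lemma P_star_cond_eq: "P_star_cond a z = uniform_measure (P_star a) {S \<in> space (P_star a). settles a z S}"
  unfolding P_star_cond_def
proof (rule measure_eqI)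
  fix A assume "A \<in> sets (uniform_measure (P_star a) {S \<in> space (P_star a). Z_lim a S = z})"
  then have A [measurable]: "A \<in> sets (P_star a)" by simp
  note pred_Z_lim [measurable]
  have eq: "emeasure (P_star a) ({S \<in> space (P_star a). Z_lim a S = z} \<inter> B) =
      emeasure (P_star a) ({S \<in> space (P_star a). settles a z S} \<inter> B)" if [measurable]: "B \<in> sets (P_star a)" for B
    using AE_Z_lim[of z] by (intro emeasure_eq_AE) auto
  show "emeasure (uniform_measure (P_star a) {S \<in> space (P_star a). Z_lim a S = z}) A =
      emeasure (uniform_measure (P_star a) {S \<in> space (P_star a). settles a z S}) A"
    \<comment> \<open>The whole space as \<open>B\<close> treats the normalising
      denominator.\<close>
    using eq[OF A] eq[OF sets.top] by (simp add: Int_absorb2)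
qed simp

lemma settles_iff_in: "settles a z S \<longleftrightarrow> (\<forall>\<^sub>F n in sequentially. S n \<in> {v. int (fst v) - int (card (M_set a n)) = z})"
  by (simp add: settles_def displacement_def)

lemma P_star_cond_in_path_laws:
  assumes "z \<in> Z_range a"
  shows "P_star_cond a z \<in> path_laws (\<lambda>h t. a (h + t)) (\<lambda>h t. 1)"
  unfolding P_star_cond_eq
proof (rule PS.uniform_measure_in_path_laws)
  show "PS.ind n (settles a z)" for n
    using PS.past_indep_eventually unfolding settles_iff_in[abs_def] .
qed (use assms in \<open>auto simp: mem_Z_range_iff\<close>)

end


section \<open>Recurrent and escaping laws\<close>

lemma take_history: "k \<le> n \<Longrightarrow> take (Suc k) (history n S) = history k S"
  by (simp add: list_eq_iff_nth_eq)

text \<open>Given the endpoint, the probability of \<open>X\<close> is the weight share of the paths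
  satisfying \<open>X\<close>. A bound on this share for all admissible endpoints is averaged over
  the endpoint, so it transfers to every law of the class.\<close>

lemma (in conditioned_law) prob_past_le:
  assumes le: "\<And>h t. h + t = n \<Longrightarrow> U h \<Longrightarrow> (\<Sum>\<gamma> | \<gamma> \<in> paths_to h t \<and> X \<gamma>. w \<gamma>) \<le> c * d h t"
    and c: "c \<ge> 0"
  shows "prob {S \<in> space P. X (history n S) \<and> U (fst (S n))} \<le> c"
proof -
  note [measurable] = pred_history[of X]
  let ?H = "{h. h \<le> n \<and> U h}"
  have "{S \<in> space P. X (history n S) \<and> U (fst (S n))} =
      (\<Union>h\<in>?H. {S \<in> space P. True \<and> S n = (h, n - h) \<and> X (history n S)})"
    using standard_path_sum[of _ n] unfolding space_eq by (fastforce simp: prod_eq_iff)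
  also have "prob \<dots> = (\<Sum>h\<in>?H. prob {S \<in> space P. True \<and> S n = (h, n - h) \<and> X (history n S)})"
    by (rule finite_measure_finite_Union) (auto simp: disjoint_family_on_def)
  also have "\<dots> \<le> (\<Sum>h\<in>?H. c * prob {S \<in> space P. S n = (h, n - h)})"
  proof (rule sum_mono)
    fix h assume h: "h \<in> ?H"
    then have "(\<Sum>\<gamma> | \<gamma> \<in> paths_to h (n - h) \<and> X \<gamma>. w \<gamma>) / d h (n - h) \<le> c"
      using le[of h "n - h"] d_pos by (simp add: divide_le_eq)
    then have "(\<Sum>\<gamma> | \<gamma> \<in> paths_to h (n - h) \<and> X \<gamma>. w \<gamma>) / d h (n - h) * prob {S \<in> space P. S n = (h, n - h)}
        \<le> c * prob {S \<in> space P. S n = (h, n - h)}"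
      by (rule mult_right_mono) simp
    then show "prob {S \<in> space P. True \<and> S n = (h, n - h) \<and> X (history n S)}
        \<le> c * prob {S \<in> space P. S n = (h, n - h)}"
      using h prob_past[OF _ _ indep_True, of h "n - h" n X] by simp
  qed
  also have "\<dots> = c * prob (\<Union>h\<in>?H. {S \<in> space P. S n = (h, n - h)})"
    unfolding sum_distrib_left[symmetric]
    by (subst finite_measure_finite_Union) (auto simp: disjoint_family_on_def)
  also have "\<dots> \<le> c * 1" using c by (intro mult_left_mono) auto
  finally show ?thesis by simp
qed

section \<open>Laws concentrated on one path\<close>

lemma path_law_eq_return:
  assumes "path_law P" "standard_path S0" "AE S in P. S = S0"
  shows "P = return path_space S0"
proof (rule measure_eqI)
  interpret path_law P by fact
  show "sets P = sets (return path_space S0)" by (simp add: sets_eq)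
  fix A assume A: "A \<in> sets P"
  show "emeasure P A = emeasure (return path_space S0) A"
  proof (cases "S0 \<in> A")
    case True
    have "AE S in P. S \<in> A" using assms(3) by (rule eventually_mono) (use True in simp)
    then have "emeasure P A = 1" by (rule emeasure_eq_1_AE[OF A])
    then show ?thesis using A True by (simp add: sets_eq)
  next
    case False
    have "AE S in P. S \<notin> A" using assms(3) by (rule eventually_mono) (use False in simp)
    then have "emeasure P {S \<in> space P. S \<in> A} = 0" by (rule emeasure_eq_0_AE)
    moreover have "{S \<in> space P. S \<in> A} = A" using sets.sets_into_space[OF A] by auto
    ultimately show ?thesis using A False by (simp add: sets_eq)
  qed
qed

lemma path_of_steps_const: "path_of_steps (\<lambda>_. True) = (\<lambda>n. (n, 0))" "path_of_steps (\<lambda>_. False) = (\<lambda>n. (0, n))"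
  by (auto simp: path_of_steps_def)

lemma paths_to_axis:
  "paths_to n 0 = {history n (\<lambda>n. (n, 0))}" "paths_to 0 n = {history n (\<lambda>n. (0, n))}"
proof -
  have "layer n n = {{..<n}}"
    by (auto simp: layer_def) (metis card_lessThan card_subset_eq finite_lessThan lessThan_iff)
  then have "paths_to n 0 = {history n (path_of_steps (\<lambda>m. m \<in> {..<n}))}"
    using bij_betw_imp_surj_on[OF bij_betw_layer_paths_to[of n 0 n]] by simp
  also have "history n (path_of_steps (\<lambda>m. m \<in> {..<n})) = history n (path_of_steps (\<lambda>_. True))"
    unfolding history_path_of_steps_eq_iff by simp
  finally show "paths_to n 0 = {history n (\<lambda>n. (n, 0))}" by (simp add: path_of_steps_const)
  have "layer n 0 = {{}}" by (auto simp: layer_def finite_subset)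
  then have "paths_to 0 n = {history n (path_of_steps (\<lambda>m. m \<in> {}))}"
    using bij_betw_imp_surj_on[OF bij_betw_layer_paths_to[of 0 n n]] by simp
  then show "paths_to 0 n = {history n (\<lambda>n. (0, n))}" by (simp add: path_of_steps_const)
qed

text \<open>If \<open>S0\<close> is the only way to reach each of its vertices, the weight of its
  history is the whole \<open>path_dim\<close>, and the prescribed conditional probability is
  1.\<close>

lemma return_in_path_laws:
  assumes pos: "\<And>h t. w0 h t > 0" "\<And>h t. w1 h t > 0"
    and S0: "standard_path S0"
    and single: "\<And>n. paths_to (fst (S0 n)) (snd (S0 n)) = {history n S0}"
  shows "return path_space S0 \<in> path_laws w0 w1"
proof -
  let ?P = "return path_space S0"
  interpret path_law ?P
    using S0 by (intro path_law.intro path_law_axioms.intro prob_space_return) (auto simp: space_path_space)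
  have prob: "prob {S \<in> space ?P. Q S} = (if Q S0 then 1 else 0)" if "Measurable.pred ?P Q" for Q
    using that S0 by (subst measure_return) (auto simp: pred_def space_path_space)
  have "past_indep w0 w1 ?P n (\<lambda>_. True)" for n
    unfolding past_indep_def
  proof (intro allI impI)
    fix h t \<gamma> assume n: "h + t = n" and \<gamma>: "\<gamma> \<in> paths_to h t"
    have hist: "prob {S \<in> space ?P. True \<and> history n S = \<gamma>} = (if True \<and> history n S0 = \<gamma> then 1 else 0)"
      by (rule prob[of "\<lambda>S. True \<and> history n S = \<gamma>"]) measurable
    have at: "prob {S \<in> space ?P. True \<and> S n = (h, t)} = (if True \<and> S0 n = (h, t) then 1 else 0)"
      by (rule prob[of "\<lambda>S. True \<and> S n = (h, t)"]) measurable
    show "prob {S \<in> space ?P. True \<and> history n S = \<gamma>} =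
        path_weight w0 w1 \<gamma> / path_dim w0 w1 h t * prob {S \<in> space ?P. True \<and> S n = (h, t)}"
    proof (cases "S0 n = (h, t)")
      case True
      then have paths: "paths_to h t = {history n S0}" using single[of n] by simp
      then have "path_dim w0 w1 h t = path_weight w0 w1 (history n S0)" by (simp add: path_dim_def)
      moreover have "path_weight w0 w1 (history n S0) > 0" by (intro path_weight_pos pos)
      ultimately show ?thesis unfolding hist at using True \<gamma> paths by simp
    next
      case False
      then have "history n S0 \<noteq> \<gamma>" using last_paths_to[OF \<gamma>] last_history[of n S0] by metis
      then show ?thesis unfolding hist at using False by simp
    qed
  qed
  then show ?thesis unfolding path_laws_iff using path_law_axioms by blast
qed

section \<open>Laws whose displacement tends to infinity\<close>

context summable_weights
begin

abbreviation laws :: "(nat \<Rightarrow> nat \<times> nat) measure set" where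
  "laws \<equiv> path_laws (\<lambda>h t. a (h + t)) (\<lambda>h t. 1)"

lemma conditioned_law_if_in_laws:
  "P \<in> laws \<Longrightarrow> conditioned_law P (\<lambda>h t. a (h + t)) (\<lambda>h t. 1)"
  using pos by (simp add: path_laws_iff conditioned_law_def conditioned_law_axioms_def)

lemma path_dim_layer:
  "h + t = n \<Longrightarrow> path_dim (\<lambda>h t. a (h + t)) (\<lambda>h t. 1) h t = (\<Sum>A\<in>layer n h. layer_weight a n A)"
  using sum_paths_to[of h t n a "\<lambda>_. True"] by (simp add: path_dim_def)

text \<open>Step \<open>j\<close> can be read off the list entries \<open>j\<close> and
  \<open>j + 1\<close>. The truth value \<open>b\<close> lets one statement serve horizontal and
  vertical steps.\<close>

lemma sum_paths_to_step:
  assumes "h + t = n" "j < n"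
  shows "(\<Sum>\<gamma> | \<gamma> \<in> paths_to h t \<and> (fst (\<gamma> ! Suc j) = Suc (fst (\<gamma> ! j))) = b.
      path_weight (\<lambda>h t. a (h + t)) (\<lambda>h t. 1) \<gamma>) =
    (\<Sum>A | A \<in> layer n h \<and> (j \<in> A) = b. layer_weight a n A)"
proof -
  have "fst (history n (path_of_steps (\<lambda>m. m \<in> A)) ! Suc j) = Suc (fst (history n (path_of_steps (\<lambda>m. m \<in> A)) ! j))
      \<longleftrightarrow> j \<in> A" for A
    using assms(2) steps_of_path_of_steps[of "\<lambda>m. m \<in> A"] unfolding steps_of_def by (auto dest: fun_cong[of _ _ j])
  with sum_paths_to[OF assms(1), where a = a and Q = "\<lambda>\<gamma>. (fst (\<gamma> ! Suc j) = Suc (fst (\<gamma> ! j))) = b"]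
  show ?thesis by simp
qed

lemma le_divide_Suc: "real (Suc K) * s \<le> c * d \<Longrightarrow> s \<le> c / real (Suc K) * d" for c d s :: real
  by (simp add: field_simps)

text \<open>The bound of \<open>sum_L_set_le\<close> and \<open>sum_M_set_le\<close>, common to both
  tails and to all \<open>n\<close>.\<close>

definition tail_const :: real where
  "tail_const = 4 * (\<Sum>n. a n / (1 + a n)\<^sup>2)"

lemma tail_const_nonneg: "tail_const \<ge> 0"
  unfolding tail_const_def using pos by (intro mult_nonneg_nonneg suminf_nonneg sum) (auto simp: less_imp_le)

text \<open>At each endpoint with displacement above \<open>K\<close>, the layer bound has a factor
  of at least \<open>K + 1\<close> on its left. The resulting bound is independent of
  \<open>n\<close>.\<close>

lemma prob_missing_step_le:
  assumes P: "P \<in> laws" and j: "j < n"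
  shows "\<P>(S in P. \<not> steps_of S j \<and> displacement a n S > int K) \<le> a j * tail_const / real (Suc K)"
proof -
  interpret conditioned_law P "\<lambda>h t. a (h + t)" "\<lambda>h t. 1" by (rule conditioned_law_if_in_laws[OF P])
  have "prob {S \<in> space P. (fst (history n S ! Suc j) = Suc (fst (history n S ! j))) = False \<and>
      int (fst (S n)) - int (card (M_set a n)) > int K} \<le> a j * tail_const / real (Suc K)"
  proof (rule prob_past_le)
    show "0 \<le> a j * tail_const / real (Suc K)" using tail_const_nonneg pos[of j] by simp
    fix h t assume n: "h + t = n" and h: "int h - int (card (M_set a n)) > int K"
    let ?s = "\<Sum>A | A \<in> layer n h \<and> (j \<in> A) = False. layer_weight a n A"
    let ?d = "\<Sum>A\<in>layer n h. layer_weight a n A"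
    have nonneg: "?s \<ge> 0" "?d \<ge> 0" using pos by (auto intro!: sum_nonneg layer_weight_nonneg)
    have "real (Suc K) * ?s \<le> (real (Suc h) - real (card (M_set a n))) * ?s"
      using h nonneg by (intro mult_right_mono) auto
    also have "\<dots> \<le> a j * (\<Sum>j\<in>L_set a n. 1 / a j) * ?d"
      using layer_weight_missing_step[where a = a and j = j and n = n and h = h, OF pos j] h by simp
    also have "\<dots> \<le> a j * tail_const * ?d"
      unfolding tail_const_def using pos[of j] nonneg
      by (intro mult_right_mono mult_left_mono sum_L_set_le pos sum) auto
    finally have "?s \<le> a j * tail_const / real (Suc K) * ?d" by (rule le_divide_Suc)
    then show "(\<Sum>\<gamma> | \<gamma> \<in> paths_to h t \<and> (fst (\<gamma> ! Suc j) = Suc (fst (\<gamma> ! j))) = False. w \<gamma>)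
        \<le> a j * tail_const / real (Suc K) * d h t"
      unfolding sum_paths_to_step[OF n j] path_dim_layer[OF n] .
  qed
  then show ?thesis using j by (simp add: steps_of_def displacement_def)
qed

lemma prob_present_step_le:
  assumes P: "P \<in> laws" and j: "j < n"
  shows "\<P>(S in P. steps_of S j \<and> displacement a n S < - int K) \<le> 1 / a j * tail_const / real (Suc K)"
proof -
  interpret conditioned_law P "\<lambda>h t. a (h + t)" "\<lambda>h t. 1" by (rule conditioned_law_if_in_laws[OF P])
  have "prob {S \<in> space P. (fst (history n S ! Suc j) = Suc (fst (history n S ! j))) = True \<and>
      int (fst (S n)) - int (card (M_set a n)) < - int K} \<le> 1 / a j * tail_const / real (Suc K)"
  proof (rule prob_past_le)
    show "0 \<le> 1 / a j * tail_const / real (Suc K)" using tail_const_nonneg pos[of j] by simp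
    fix h t assume n: "h + t = n" and h: "int h - int (card (M_set a n)) < - int K"
    let ?s = "\<Sum>A | A \<in> layer n h \<and> (j \<in> A) = True. layer_weight a n A"
    let ?d = "\<Sum>A\<in>layer n h. layer_weight a n A"
    have nonneg: "?s \<ge> 0" "?d \<ge> 0" using pos by (auto intro!: sum_nonneg layer_weight_nonneg)
    have "real (Suc K) * ?s \<le> (real (card (M_set a n)) + 1 - real h) * ?s"
      using h nonneg by (intro mult_right_mono) auto
    also have "\<dots> \<le> 1 / a j * (\<Sum>j\<in>M_set a n. a j) * ?d"
      using layer_weight_present_step[where a = a and j = j and n = n and h = h, OF pos j] h by simp
    also have "\<dots> \<le> 1 / a j * tail_const * ?d"
      unfolding tail_const_def using pos[of j] nonneg
      by (intro mult_right_mono mult_left_mono sum_M_set_le pos sum) auto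
    finally have "?s \<le> 1 / a j * tail_const / real (Suc K) * ?d" by (rule le_divide_Suc)
    then show "(\<Sum>\<gamma> | \<gamma> \<in> paths_to h t \<and> (fst (\<gamma> ! Suc j) = Suc (fst (\<gamma> ! j))) = True. w \<gamma>)
        \<le> 1 / a j * tail_const / real (Suc K) * d h t"
      unfolding sum_paths_to_step[OF n j] path_dim_layer[OF n] .
  qed
  then show ?thesis using j by (simp add: steps_of_def displacement_def)
qed

text \<open>The bound on a vertical step at \<open>j\<close> holds for all \<open>n > j\<close> and
  tends to 0 in \<open>K\<close>, so almost surely every step is horizontal.\<close>

lemma escape_right:
  assumes P: "P \<in> laws" and ae: "\<And>K. AE S in P. \<forall>\<^sub>F n in sequentially. displacement a n S > int K"
  shows "P = Q_inf_0"
proof -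
  interpret conditioned_law P "\<lambda>h t. a (h + t)" "\<lambda>h t. 1" by (rule conditioned_law_if_in_laws[OF P])
  \<comment> \<open>The double negation fits \<open>AE_not_if_prob_bounds\<close>, applied to the
    event of a vertical step.\<close>
  have "AE S in P. \<not> \<not> steps_of S j" for j
  proof (rule AE_not_if_prob_bounds)
    show "prob {S \<in> space P. \<not> steps_of S j \<and> displacement a n S > int K} \<le> a j * tail_const / real (Suc K)"
      if "n > j" for n K using prob_missing_step_le[OF P that] .
  qed (use ae in measurable)
  then have "AE S in P. \<forall>j. steps_of S j" by (simp add: AE_all_countable)
  then have "AE S in P. S = (\<lambda>n. (n, 0))"
  proof (rule AE_mp, intro AE_I2 impI)
    fix S assume "S \<in> space P" "\<forall>j. steps_of S j"
    then have "steps_of S = (\<lambda>_. True)" "path_of_steps (steps_of S) = S"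
      by (auto simp: space_eq path_of_steps_steps_of)
    then show "S = (\<lambda>n. (n, 0))" by (simp add: path_of_steps_const)
  qed
  moreover have "standard_path (\<lambda>n. (n, 0))" by (simp add: standard_path_def lattice_edge_def)
  ultimately show ?thesis unfolding Q_inf_0_def by (intro path_law_eq_return path_law_axioms)
qed

lemma escape_left:
  assumes P: "P \<in> laws" and ae: "\<And>K. AE S in P. \<forall>\<^sub>F n in sequentially. displacement a n S < - int K"
  shows "P = Q_0_inf"
proof -
  interpret conditioned_law P "\<lambda>h t. a (h + t)" "\<lambda>h t. 1" by (rule conditioned_law_if_in_laws[OF P])
  have "AE S in P. \<not> steps_of S j" for j
  proof (rule AE_not_if_prob_bounds)
    show "prob {S \<in> space P. steps_of S j \<and> displacement a n S < - int K} \<le> 1 / a j * tail_const / real (Suc K)"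
      if "n > j" for n K using prob_present_step_le[OF P that] .
  qed (use ae in measurable)
  then have "AE S in P. \<forall>j. \<not> steps_of S j" by (simp add: AE_all_countable)
  then have "AE S in P. S = (\<lambda>n. (0, n))"
  proof (rule AE_mp, intro AE_I2 impI)
    fix S assume "S \<in> space P" "\<forall>j. \<not> steps_of S j"
    then have "steps_of S = (\<lambda>_. False)" "path_of_steps (steps_of S) = S"
      by (auto simp: space_eq path_of_steps_steps_of)
    then show "S = (\<lambda>n. (0, n))" by (simp add: path_of_steps_const)
  qed
  moreover have "standard_path (\<lambda>n. (0, n))" by (simp add: standard_path_def lattice_edge_def)
  ultimately show ?thesis unfolding Q_0_inf_def by (intro path_law_eq_return path_law_axioms)
qed

section \<open>Recurrence at a level\<close>

lemma prob_P_star_at_pos: "\<P>(S in P_star a. S (h + t) = (h, t)) > 0"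
proof -
  obtain \<gamma> where \<gamma>: "\<gamma> \<in> paths_to h t" using paths_to_nonempty by blast
  have "0 < \<P>(S in P_star a. history (h + t) S = \<gamma>)"
    unfolding prob_P_star_history_eq_weight[OF pos \<gamma>] using pos
    by (intro mult_pos_pos prod_pos PS.w_pos) (auto simp: prob_h_def add_pos_pos)
  also have "\<dots> \<le> \<P>(S in P_star a. S (h + t) = (h, t))"
    using last_paths_to[OF \<gamma>] last_history by (intro PS.finite_measure_mono) fastforce+
  finally show ?thesis .
qed

text \<open>At time \<open>n\<close> the displacement fixes the vertex, and given the vertex the
  past has the same law under \<open>P\<close> and under \<open>P_star\<close>. The condition
  \<open>B\<close> does not disturb this, being independent of the past.\<close>

lemma prob_past_displacement:
  assumes P: "P \<in> laws" and [measurable]: "Measurable.pred P B"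
    and ind: "past_indep (\<lambda>h t. a (h + t)) (\<lambda>h t. 1) P n B" and k: "k \<le> n"
  shows "\<P>(S in P. B S \<and> displacement a n S = z \<and> history k S = \<gamma>) =
    \<P>(S in P_star a. displacement a n S = z \<and> history k S = \<gamma>) / \<P>(S in P_star a. displacement a n S = z)
      * \<P>(S in P. B S \<and> displacement a n S = z)"
proof -
  interpret conditioned_law P "\<lambda>h t. a (h + t)" "\<lambda>h t. 1" by (rule conditioned_law_if_in_laws[OF P])
  define x where "x = z + int (card (M_set a n))"
  show ?thesis
  proof (cases "0 \<le> x \<and> x \<le> int n")
    case True
    define h t where "h = nat x" and "t = n - h"
    have n: "h + t = n" using True by (simp add: h_def t_def nat_le_iff)
    have D: "displacement a n S = z \<longleftrightarrow> S n = (h, t)" if "standard_path S" for S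
    proof -
      have "displacement a n S = z \<longleftrightarrow> int (fst (S n)) = x" by (auto simp: displacement_def x_def)
      then show ?thesis using True standard_path_eq_iff[OF that n] by (auto simp: h_def)
    qed
    have hist: "history k S = \<gamma> \<longleftrightarrow> take (Suc k) (history n S) = \<gamma>" for S :: "nat \<Rightarrow> nat \<times> nat"
      by (simp add: take_history[OF k])
    \<comment> \<open>The weight share of the paths with prefix \<gamma>, which \<open>P\<close> and
      \<open>P_star\<close> have in common.\<close>
    let ?\<kappa> = "(\<Sum>\<eta> | \<eta> \<in> paths_to h t \<and> take (Suc k) \<eta> = \<gamma>. w \<eta>) / d h t"
    have sets: "{S \<in> space Q. R S \<and> displacement a n S = z} = {S \<in> space Q. R S \<and> S n = (h, t)}"
      "{S \<in> space Q. R S \<and> displacement a n S = z \<and> history k S = \<gamma>} =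
        {S \<in> space Q. R S \<and> S n = (h, t) \<and> take (Suc k) (history n S) = \<gamma>}" if "path_law Q" for Q R
      using D path_law.space_eq[OF that] by (auto simp: hist)
    have "prob {S \<in> space P. B S \<and> displacement a n S = z \<and> history k S = \<gamma>} =
        ?\<kappa> * prob {S \<in> space P. B S \<and> displacement a n S = z}"
      unfolding sets[OF path_law_axioms] by (rule prob_past[OF _ n ind]) measurable
    moreover have "\<P>(S in P_star a. displacement a n S = z \<and> history k S = \<gamma>) =
        ?\<kappa> * \<P>(S in P_star a. displacement a n S = z)"
      using sets[OF PS.path_law_axioms, of "\<lambda>_. True"]
        PS.prob_past[OF _ n PS.indep_True, of "\<lambda>\<eta>. take (Suc k) \<eta> = \<gamma>"] by simp
    moreover have "\<P>(S in P_star a. displacement a n S = z) > 0"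
      using sets(1)[OF PS.path_law_axioms, of "\<lambda>_. True"] prob_P_star_at_pos[of h t] n by simp
    ultimately show ?thesis by simp
  next
    case False
    \<comment> \<open>Level \<open>z\<close> is out of reach at time \<open>n\<close>, so both
      probabilities under \<open>P\<close> are zero, whatever the value of the quotient.\<close>
    have "displacement a n S \<noteq> z" if "standard_path S" for S
      using False standard_path_sum[OF that, of n] by (auto simp: displacement_def x_def)
    then have "{S \<in> space P. B S \<and> displacement a n S = z} = {}"
      "{S \<in> space P. B S \<and> displacement a n S = z \<and> history k S = \<gamma>} = {}"
      unfolding space_eq by auto
    then show ?thesis by (simp only: measure_empty mult_zero_right)
  qed
qed

text \<open>The last visit before time \<open>N\<close> is used because its occurrence at time \<open>n\<close> concerns only the path
  from time \<open>n\<close> on, so that it is \<open>past_indep\<close> at \<open>n\<close>; a first visit is not.\<close>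

lemma prob_last_visit:
  assumes "path_law P" and [measurable]: "Measurable.pred P Q"
  shows "\<P>(S in P. (\<exists>n\<in>{K..N}. displacement a n S = z) \<and> Q S) =
    (\<Sum>n\<in>{K..N}. \<P>(S in P. (\<forall>m\<ge>Suc n. m \<le> N \<longrightarrow> displacement a m S \<noteq> z) \<and> displacement a n S = z \<and> Q S))"
proof -
  interpret path_law P by fact
  let ?B = "\<lambda>n S. \<forall>m\<ge>Suc n. m \<le> N \<longrightarrow> displacement a m S \<noteq> z"
  have "{S \<in> space P. (\<exists>n\<in>{K..N}. displacement a n S = z) \<and> Q S} =
      (\<Union>n\<in>{K..N}. {S \<in> space P. ?B n S \<and> displacement a n S = z \<and> Q S})"
  proof (intro equalityI subsetI)
    fix S assume S: "S \<in> {S \<in> space P. (\<exists>n\<in>{K..N}. displacement a n S = z) \<and> Q S}"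
    let ?V = "{n \<in> {K..N}. displacement a n S = z}"
    have "Max ?V \<in> ?V" using S by (intro Max_in) auto
    moreover have "?B (Max ?V) S"
    proof (intro allI impI notI)
      fix m assume "Suc (Max ?V) \<le> m" "m \<le> N" "displacement a m S = z"
      moreover from this have "m \<in> ?V" using \<open>Max ?V \<in> ?V\<close> by auto
      then have "m \<le> Max ?V" by (intro Max_ge) auto
      ultimately show False by simp
    qed
    ultimately show "S \<in> (\<Union>n\<in>{K..N}. {S \<in> space P. ?B n S \<and> displacement a n S = z \<and> Q S})"
      using S by blast
  qed auto
  also have "prob \<dots> = (\<Sum>n\<in>{K..N}. prob {S \<in> space P. ?B n S \<and> displacement a n S = z \<and> Q S})"
  proof (rule finite_measure_finite_Union)
    show "disjoint_family_on (\<lambda>n. {S \<in> space P. ?B n S \<and> displacement a n S = z \<and> Q S}) {K..N}"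
      unfolding disjoint_family_on_def
    proof (intro ballI impI)
      fix m n assume "m \<in> {K..N}" "n \<in> {K..N}" "m \<noteq> n"
      then have "Suc m \<le> n \<and> n \<le> N \<or> Suc n \<le> m \<and> m \<le> N" by auto
      then show "{S \<in> space P. ?B m S \<and> displacement a m S = z \<and> Q S} \<inter>
          {S \<in> space P. ?B n S \<and> displacement a n S = z \<and> Q S} = {}" by blast
    qed
  qed (auto intro!: image_subsetI)
  finally show ?thesis .
qed

text \<open>Almost surely the displacement is eventually constant, so late times decide whether the
  constant is \<open>z\<close>.\<close>

lemma AE_eventually_displacement_iff:
  "AE S in P_star a. \<forall>\<^sub>F n in sequentially. displacement a n S = z \<longleftrightarrow> settles a z S"
  using AE_settles
proof eventually_elim
  case (elim S)
  then obtain z' where z': "settles a z' S" by blast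
  then have "settles a z S \<longleftrightarrow> z' = z" using settles_unique by blast
  with z' show ?case unfolding settles_def by (auto elim: eventually_mono)
qed

text \<open>Each piece of the decomposition by the last visit to \<open>z\<close> in a window gives
  the history \<gamma> a share \<open>f n\<close>, which is close to its limit \<open>L\<close> for
  late visits. As the window grows, the pieces exhaust the space, so \<gamma> has probability
  \<open>L\<close>.\<close>

lemma recurrent_imp:
  assumes P: "P \<in> laws" and ae: "AE S in P. \<exists>\<^sub>F n in sequentially. displacement a n S = z"
  shows "z \<in> Z_range a" and "P = P_star_cond a z"
proof -
  interpret conditioned_law P "\<lambda>h t. a (h + t)" "\<lambda>h t. 1" by (rule conditioned_law_if_in_laws[OF P])
  show z: "z \<in> Z_range a"
  proof (rule ccontr)
    assume "z \<notin> Z_range a"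
    \<comment> \<open>By \<open>prob_settles_pos\<close>, no path ever attains a level outside the
      range.\<close>
    then have "displacement a n S \<noteq> z" if "S \<in> space P" for n S
      using that prob_settles_pos unfolding mem_Z_range_iff space_eq by blast
    then have "AE S in P. \<not> (\<exists>\<^sub>F n in sequentially. displacement a n S = z)"
      by (intro AE_I2) (simp add: not_frequently)
    with ae have "AE S in P. False" by eventually_elim simp
    then show False by simp
  qed
  have e: "emeasure (P_star a) {S \<in> space (P_star a). settles a z S} \<noteq> 0"
    using z by (auto simp: mem_Z_range_iff PS.emeasure_eq_measure)
  interpret C: path_law "P_star_cond a z"
    using P_star_cond_in_path_laws[OF z] by (simp add: path_laws_iff)
  show "P = P_star_cond a z"
  proof (rule path_law_eqI[OF path_law_axioms C.path_law_axioms])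
    fix k and S0 :: "nat \<Rightarrow> nat \<times> nat"
    define \<gamma> where "\<gamma> = history k S0"
    define f where "f n = \<P>(S in P_star a. displacement a n S = z \<and> history k S = \<gamma>)
      / \<P>(S in P_star a. displacement a n S = z)" for n
    define L where "L = measure (P_star_cond a z) {S \<in> space (P_star_cond a z). history k S = \<gamma>}"
    have L: "L = \<P>(S in P_star a. settles a z S \<and> history k S = \<gamma>) / \<P>(S in P_star a. settles a z S)"
      unfolding L_def P_star_cond_eq using e
      by (subst measure_uniform_measure)
         (auto intro!: arg_cong2[where f = "(/)"] arg_cong[where f = PS.prob])
    have "f \<longlonglongrightarrow> L"
      unfolding f_def L
    proof (intro tendsto_divide PS.prob_tendsto)
      show "\<P>(S in P_star a. settles a z S) \<noteq> 0" using z by (simp add: mem_Z_range_iff)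
      show "AE S in P_star a. \<forall>\<^sub>F n in sequentially.
          (displacement a n S = z \<and> history k S = \<gamma>) = (settles a z S \<and> history k S = \<gamma>)"
        using AE_eventually_displacement_iff[of z] by eventually_elim (erule eventually_mono, simp)
    qed (use AE_eventually_displacement_iff[of z] in measurable)
    have "\<bar>prob {S \<in> space P. history k S = \<gamma>} - L\<bar> \<le> \<epsilon>" if \<epsilon>: "\<epsilon> > 0" for \<epsilon>
    proof -
      have "\<forall>\<^sub>F n in sequentially. \<bar>f n - L\<bar> < \<epsilon>"
        using \<open>f \<longlonglongrightarrow> L\<close> \<epsilon> by (simp add: tendsto_iff dist_real_def)
      then obtain K0 where K0: "\<And>n. n \<ge> K0 \<Longrightarrow> \<bar>f n - L\<bar> < \<epsilon>" by (auto simp: eventually_sequentially)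
      \<comment> \<open>The bound \<open>k\<close> puts the history in the past of every visit
        counted, and \<open>K0\<close> makes \<open>f n\<close> close to \<open>L\<close>
        there.\<close>
      define K where "K = max k K0"
      define V where "V N S \<longleftrightarrow> (\<exists>n\<in>{K..N}. displacement a n S = z)" for N S
      let ?B = "\<lambda>N n S. \<forall>m\<ge>Suc n. m \<le> N \<longrightarrow> displacement a m S \<noteq> z"
      have [measurable]: "Measurable.pred P (V N)" for N unfolding V_def[abs_def] by measurable
      have V_ae: "AE S in P. \<forall>\<^sub>F N in sequentially. V N S"
        using ae
      proof eventually_elim
        case (elim S)
        then obtain n where "n \<ge> K" "displacement a n S = z"
          unfolding frequently_sequentially by blast
        then show ?case by (intro eventually_sequentiallyI[of n]) (auto simp: V_def)
      qed
      \<comment> \<open>The conjunct \<open>True\<close> gives both probabilities the form to which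
        \<open>lim\<close> applies.\<close>
      have bound: "\<bar>prob {S \<in> space P. V N S \<and> history k S = \<gamma>} - L * prob {S \<in> space P. V N S \<and> True}\<bar> \<le> \<epsilon>" for N
      proof -
        have B: "prob {S \<in> space P. ?B N n S \<and> displacement a n S = z \<and> history k S = \<gamma>} =
            f n * prob {S \<in> space P. ?B N n S \<and> displacement a n S = z}" if "n \<in> {K..N}" for n
          unfolding f_def
        proof (rule prob_past_displacement[OF P])
          \<comment> \<open>With \<open>m \<le> N\<close> moved into the set, avoiding
            \<open>z\<close> up to \<open>N\<close> becomes a constraint at all times from
            \<open>Suc n\<close> on.\<close>
          let ?G = "\<lambda>m. {v. m \<le> N \<longrightarrow> int (fst v) - int (card (M_set a m)) \<noteq> z}"
          have "ind n (\<lambda>S. \<forall>m\<ge>Suc n. S m \<in> ?G m)"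
            by (rule past_indep_antimono[OF pred_all_ge past_indep_all_ge]) simp
          then show "ind n (?B N n)" by (simp add: displacement_def)
          show "k \<le> n" using that by (simp add: K_def)
        qed measurable
        let ?p = "\<lambda>n. prob {S \<in> space P. ?B N n S \<and> displacement a n S = z}"
        have True: "prob {S \<in> space P. V N S \<and> True} = (\<Sum>n\<in>{K..N}. ?p n)"
          using prob_last_visit[OF path_law_axioms, of "\<lambda>_. True" K N z] by (simp add: V_def)
        have "prob {S \<in> space P. V N S \<and> history k S = \<gamma>} = (\<Sum>n\<in>{K..N}. f n * ?p n)"
          using prob_last_visit[OF path_law_axioms, of "\<lambda>S. history k S = \<gamma>" K N z] B by (simp add: V_def)
        then have "\<bar>prob {S \<in> space P. V N S \<and> history k S = \<gamma>} - L * prob {S \<in> space P. V N S \<and> True}\<bar>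
            = \<bar>\<Sum>n\<in>{K..N}. (f n - L) * ?p n\<bar>"
          unfolding True by (simp add: sum_distrib_left left_diff_distrib sum_subtractf)
        also have "\<dots> \<le> (\<Sum>n\<in>{K..N}. \<bar>(f n - L) * ?p n\<bar>)" by (rule sum_abs)
        also have "\<dots> \<le> (\<Sum>n\<in>{K..N}. \<epsilon> * ?p n)"
        proof (rule sum_mono)
          fix n assume "n \<in> {K..N}"
          then have "\<bar>f n - L\<bar> \<le> \<epsilon>" using K0[of n] by (simp add: K_def)
          then show "\<bar>(f n - L) * ?p n\<bar> \<le> \<epsilon> * ?p n" by (simp add: abs_mult mult_right_mono)
        qed
        also have "\<dots> = \<epsilon> * prob {S \<in> space P. V N S \<and> True}"
          unfolding True by (simp add: sum_distrib_left)
        also have "\<dots> \<le> \<epsilon> * 1" using \<epsilon> by (intro mult_left_mono) auto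
        finally show ?thesis by simp
      qed
      have lim: "(\<lambda>N. prob {S \<in> space P. V N S \<and> Q S}) \<longlonglongrightarrow> prob {S \<in> space P. Q S}"
        if [measurable]: "Measurable.pred P Q" for Q
      proof (rule prob_tendsto)
        show "AE S in P. \<forall>\<^sub>F N in sequentially. (V N S \<and> Q S) = Q S"
          using V_ae by eventually_elim (erule eventually_mono, simp)
      qed measurable
      have "(\<lambda>N. \<bar>prob {S \<in> space P. V N S \<and> history k S = \<gamma>} - L * prob {S \<in> space P. V N S \<and> True}\<bar>)
          \<longlonglongrightarrow> \<bar>prob {S \<in> space P. history k S = \<gamma>} - L * prob {S \<in> space P. True}\<bar>"
        by (intro tendsto_intros lim) measurable
      then have "\<bar>prob {S \<in> space P. history k S = \<gamma>} - L * prob {S \<in> space P. True}\<bar> \<le> \<epsilon>"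
        by (rule LIMSEQ_le_const2) (use bound in blast)
      then show ?thesis by (simp add: prob_space)
    qed
    then have "\<bar>prob {S \<in> space P. history k S = \<gamma>} - L\<bar> \<le> 0" by (rule field_le_epsilon) simp
    then show "prob {S \<in> space P. history k S = history k S0} =
        measure (P_star_cond a z) {S \<in> space (P_star_cond a z). history k S = history k S0}"
      by (simp add: L_def \<gamma>_def)
  qed
qed

section \<open>Classification of the extreme laws\<close>

text \<open>The finitely many levels between \<open>- K\<close> and \<open>K\<close> are eventually
  avoided. After the last visit to 0 the sign can no longer change, because the displacement moves
  by at most one.\<close>

lemma not_recurrent_cases:
  assumes S: "standard_path S" and transient: "\<And>z. \<forall>\<^sub>F n in sequentially. displacement a n S \<noteq> z"
  shows "\<forall>\<^sub>F n in sequentially. displacement a n S > 0 \<Longrightarrow> \<forall>\<^sub>F n in sequentially. displacement a n S > int K"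
    and "\<not> (\<forall>\<^sub>F n in sequentially. displacement a n S > 0) \<Longrightarrow>
      \<forall>\<^sub>F n in sequentially. displacement a n S < - int K"
proof -
  have avoid: "\<forall>\<^sub>F n in sequentially. \<forall>z\<in>{- int K..int K}. displacement a n S \<noteq> z"
    by (intro eventually_ball_finite) (use transient in auto)
  show "\<forall>\<^sub>F n in sequentially. displacement a n S > int K" if "\<forall>\<^sub>F n in sequentially. displacement a n S > 0"
    using avoid that by eventually_elim force
  show "\<forall>\<^sub>F n in sequentially. displacement a n S < - int K"
    if not_pos: "\<not> (\<forall>\<^sub>F n in sequentially. displacement a n S > 0)"
  proof -
    obtain k where k: "\<And>m. m \<ge> k \<Longrightarrow> displacement a m S \<noteq> 0"
      using transient[of 0] by (auto simp: eventually_sequentially)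
    obtain m where m: "m \<ge> k" "\<not> displacement a m S > 0"
      using not_pos by (auto simp: eventually_sequentially)
    have "displacement a n S < 0" if "n \<ge> m" for n
      using that
    proof (induction rule: dec_induct)
      case base
      then show ?case using m k[of m] by simp
    next
      case (step n)
      then have "displacement a (Suc n) S \<le> 0" using displacement_Suc[OF S, of a n] by (simp split: if_splits)
      then show ?case using k[of "Suc n"] m step by simp
    qed
    then have "\<forall>\<^sub>F n in sequentially. displacement a n S < 0" by (rule eventually_sequentiallyI)
    with avoid show ?thesis by eventually_elim force
  qed
qed

lemma extreme_law_cases:
  assumes ext: "P \<in> extreme_laws laws"
  shows "(\<exists>z\<in>Z_range a. P = P_star_cond a z) \<or> P = Q_0_inf \<or> P = Q_inf_0"
proof -
  have P: "P \<in> laws" using ext by (simp add: extreme_laws_def)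
  interpret conditioned_law P "\<lambda>h t. a (h + t)" "\<lambda>h t. 1" by (rule conditioned_law_if_in_laws[OF P])
  have zero_one: "(AE S in P. \<not> (\<forall>\<^sub>F n in sequentially. S n \<in> G n)) \<or> (AE S in P. \<forall>\<^sub>F n in sequentially. S n \<in> G n)" for G
  proof -
    have [measurable]: "Measurable.pred P (\<lambda>S. \<forall>\<^sub>F n in sequentially. S n \<in> G n)"
      unfolding eventually_sequentially by measurable
    from extreme_imp_tail_trivial[OF this past_indep_eventually ext] show ?thesis
      by (auto simp: prob_eq_0 prob_eq_1)
  qed
  show ?thesis
  proof (cases "\<exists>z. AE S in P. \<exists>\<^sub>F n in sequentially. displacement a n S = z")
    case True
    then show ?thesis using recurrent_imp[OF P] by blast
  next
    case False
    \<comment> \<open>Recurrence at \<open>z\<close> is the complement of eventually avoiding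
      \<open>z\<close>, and the latter event obeys the zero-one law.\<close>
    have "AE S in P. \<forall>\<^sub>F n in sequentially. displacement a n S \<noteq> z" for z
      using zero_one[of "\<lambda>n. {v. int (fst v) - int (card (M_set a n)) \<noteq> z}"] False
      by (auto simp: displacement_def frequently_def)
    then have "AE S in P. \<forall>z. \<forall>\<^sub>F n in sequentially. displacement a n S \<noteq> z"
      by (simp add: AE_all_countable)
    moreover have "AE S in P. standard_path S" by (rule AE_I2) (simp add: space_eq)
    ultimately have cases: "AE S in P. \<forall>K.
        ((\<forall>\<^sub>F n in sequentially. displacement a n S > 0) \<longrightarrow> (\<forall>\<^sub>F n in sequentially. displacement a n S > int K)) \<and>
        (\<not> (\<forall>\<^sub>F n in sequentially. displacement a n S > 0) \<longrightarrow> (\<forall>\<^sub>F n in sequentially. displacement a n S < - int K))"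
      by eventually_elim (use not_recurrent_cases in blast)
    \<comment> \<open>Eventual positivity also obeys the zero-one law, so the direction of escape is
      the same for almost all paths.\<close>
    have "(AE S in P. \<not> (\<forall>\<^sub>F n in sequentially. displacement a n S > 0)) \<or>
        (AE S in P. \<forall>\<^sub>F n in sequentially. displacement a n S > 0)"
      using zero_one[of "\<lambda>n. {v. int (fst v) - int (card (M_set a n)) > 0}"] by (simp add: displacement_def)
    then show ?thesis
    proof
      assume "AE S in P. \<not> (\<forall>\<^sub>F n in sequentially. displacement a n S > 0)"
      with cases have "AE S in P. \<forall>K. \<forall>\<^sub>F n in sequentially. displacement a n S < - int K"
        by eventually_elim blast
      then have "P = Q_0_inf" by (intro escape_left[OF P]) (simp add: AE_all_countable)
      then show ?thesis by simp
    next
      assume "AE S in P. \<forall>\<^sub>F n in sequentially. displacement a n S > 0"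
      with cases have "AE S in P. \<forall>K. \<forall>\<^sub>F n in sequentially. displacement a n S > int K"
        by eventually_elim blast
      then have "P = Q_inf_0" by (intro escape_right[OF P]) (simp add: AE_all_countable)
      then show ?thesis by simp
    qed
  qed
qed

section \<open>Extremality of the listed laws\<close>

lemma prob_space_if_in_laws: "P \<in> laws \<Longrightarrow> prob_space P"
  by (simp add: path_laws_def)

text \<open>Recurrence at \<open>z\<close> has probability 1 under this law, and by
  \<open>recurrent_imp\<close> under no other law of the class.\<close>

lemma P_star_cond_extreme:
  assumes z: "z \<in> Z_range a"
  shows "P_star_cond a z \<in> extreme_laws laws"
proof -
  let ?F = "\<lambda>S. \<exists>\<^sub>F n in sequentially. displacement a n S = z"
  have pred: "Measurable.pred P ?F" if "path_law P" for P
  proof -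
    interpret path_law P by fact
    show ?thesis unfolding frequently_sequentially by measurable
  qed
  interpret C: path_law "P_star_cond a z"
    using P_star_cond_in_path_laws[OF z] by (simp add: path_laws_iff)
  have e: "emeasure (P_star a) {S \<in> space (P_star a). settles a z S} \<noteq> 0"
    using z by (auto simp: mem_Z_range_iff PS.emeasure_eq_measure)
  have "AE S in P_star_cond a z. ?F S"
    unfolding P_star_cond_eq
  proof (rule AE_uniform_measureI)
    show "AE S in P_star a. S \<in> {S \<in> space (P_star a). settles a z S} \<longrightarrow> ?F S"
      by (intro AE_I2) (auto simp: settles_def intro: eventually_frequently)
  qed measurable
  then have one: "measure (P_star_cond a z) {S \<in> space (P_star_cond a z). ?F S} = 1"
    using pred[OF C.path_law_axioms] by (subst C.prob_eq_1) auto
  show ?thesis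
  proof (rule extreme_lawsI[OF P_star_cond_in_path_laws[OF z] prob_space_if_in_laws _ one])
    show "{S \<in> space (P_star_cond a z). ?F S} \<in> sets (P_star_cond a z)"
      using pred[OF C.path_law_axioms] by (simp add: pred_def)
    fix P assume P: "P \<in> laws" and "measure P {S \<in> space (P_star_cond a z). ?F S} = 1"
    interpret P: conditioned_law P "\<lambda>h t. a (h + t)" "\<lambda>h t. 1" by (rule conditioned_law_if_in_laws[OF P])
    have "P.prob {S \<in> space P. ?F S} = 1"
      using \<open>measure P _ = 1\<close> by (simp add: P.space_eq C.space_eq)
    then have "AE S in P. ?F S"
      using pred[OF P.path_law_axioms] by (subst (asm) P.prob_eq_1) auto
    then show "P = P_star_cond a z" by (rule recurrent_imp(2)[OF P])
  qed
qed

text \<open>The singleton event that the path is \<open>S0\<close> serves as the event that singles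
  out the law.\<close>

lemma return_extreme:
  assumes S0: "standard_path S0" and single: "\<And>n. paths_to (fst (S0 n)) (snd (S0 n)) = {history n S0}"
  shows "return path_space S0 \<in> extreme_laws laws"
proof -
  have in_laws: "return path_space S0 \<in> laws" using pos by (intro return_in_path_laws S0 single) auto
  then interpret R: path_law "return path_space S0" by (simp add: path_laws_iff)
  have pred: "Measurable.pred P (\<lambda>S. S = S0)" if "path_law P" for P
  proof -
    interpret path_law P by fact
    have "(\<lambda>S. S = S0) = (\<lambda>S. \<forall>n. S n = S0 n)" by auto
    then show ?thesis by simp
  qed
  have sets: "{S \<in> space (return path_space S0). S = S0} \<in> sets (return path_space S0)"
    using pred[OF R.path_law_axioms] by (simp add: pred_def)
  show ?thesis
  proof (rule extreme_lawsI[OF in_laws prob_space_if_in_laws sets])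
    show "measure (return path_space S0) {S \<in> space (return path_space S0). S = S0} = 1"
      using sets S0 by (simp add: measure_return space_path_space)
    fix P assume P: "P \<in> laws" and "measure P {S \<in> space (return path_space S0). S = S0} = 1"
    interpret P: conditioned_law P "\<lambda>h t. a (h + t)" "\<lambda>h t. 1" by (rule conditioned_law_if_in_laws[OF P])
    have "P.prob {S \<in> space P. S = S0} = 1"
      using \<open>measure P _ = 1\<close> by (simp add: P.space_eq space_path_space)
    moreover have "{S \<in> space P. S = S0} \<in> sets P"
      using pred[OF P.path_law_axioms] unfolding pred_def .
    ultimately have "AE S in P. S \<in> {S \<in> space P. S = S0}" using P.prob_eq_1 by blast
    then have "AE S in P. S = S0" by (rule eventually_mono) simp
    then show "P = return path_space S0" by (rule path_law_eq_return[OF P.path_law_axioms S0])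
  qed
qed

lemma Q_extreme: "Q_0_inf \<in> extreme_laws laws" "Q_inf_0 \<in> extreme_laws laws"
  unfolding Q_0_inf_def Q_inf_0_def
  by (rule return_extreme; simp add: paths_to_axis standard_path_def lattice_edge_def)+

end

theorem proposition8:
  fixes a :: "nat \<Rightarrow> real"
  assumes "\<And>n. a n > 0"
    and "summable (\<lambda>n. a n / (1 + a n)\<^sup>2)"
  shows "extreme_laws (path_laws (\<lambda>h t. a (h + t)) (\<lambda>h t. 1)) =
           {P_star_cond a z | z. z \<in> Z_range a} \<union> {Q_0_inf, Q_inf_0}"
proof -
  interpret summable_weights a using assms by unfold_locales
  show ?thesis using extreme_law_cases P_star_cond_extreme Q_extreme by blast
qed

end
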